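(* There is an absolute constant $C>0$ such that for all integers $n\geq 2$ and $r$ with $(\log n)^4\leq r<n$, \[ \left|\kappa(n,r)-\mathrm{e}^{-H_r}\right|\leq C\,\frac{\varrho(n/r)}{r}. \] (That is, $\kappa(n,r)=\mathrm{e}^{-H_r}+O\bigl(\varrho(n/r)/r\bigr)$ uniformly in this range.)
   Context: For integers $1\leq r<n$, $\kappa(n,r)$ denotes the probability that a permutation chosen uniformly at random from the symmetric group $\mathrm{S}_n$ has no cycles of length less than $r+1$ (i.e. all its cycles have length $>r$). $H_r=\sum_{j=1}^r 1/j$ is the $r$-th harmonic number. Dickman's function $\varrho(v)$, $v\geq 0$, is the unique continuous function with $\varrho(v)=1$ for $0\leq v\leq 1$ and $v\varrho'(v)+\varrho(v-1)=0$ for $v>1$. *)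

theory Defs
  imports "HOL-Probability.Probability" "HOL-Combinatorics.Combinatorics"
begin

text \<open>
  The cycles of \<open>p\<close> on \<open>A\<close>, as sets of points.
  A fixed point is a cycle of length 1.
\<close>

definition cycles_on :: "('a \<Rightarrow> 'a) \<Rightarrow> 'a set \<Rightarrow> 'a set set" where
  "cycles_on p A = orbit p ` A"

definition kappa :: "nat \<Rightarrow> nat \<Rightarrow> real" where
  "kappa n r = measure_pmf.prob (pmf_of_set {p. p permutes {1..n}})
     {p. \<forall>c\<in>cycles_on p {1..n}. card c > r}"

text \<open>
  The clause for \<open>v < 0\<close> only serves to make the function unique as a total function on the reals.
\<close>

definition is_dickman :: "(real \<Rightarrow> real) \<Rightarrow> bool" where
  "is_dickman f \<longleftrightarrow>
     (\<forall>v<0. f v = 0) \<and>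
     continuous_on {0..} f \<and>
     (\<forall>v\<in>{0..1}. f v = 1) \<and>
     (\<forall>v>1. f differentiable (at v) \<and> v * deriv f v + f (v - 1) = 0)"

definition dickman :: "real \<Rightarrow> real" where
  "dickman = (THE f. is_dickman f)"

lemma is_dickman_has_derivative:
  assumes "is_dickman f" "v > 1"
  shows "(f has_real_derivative (- f (v - 1) / v)) (at v)"
proof -
  have "(f has_real_derivative deriv f v) (at v)"
    using assms unfolding is_dickman_def
    by (simp add: DERIV_deriv_iff_real_differentiable)
  moreover have "v * deriv f v = - f (v - 1)"
    using assms unfolding is_dickman_def by (smt (verit))
  hence "deriv f v = - f (v - 1) / v"
    using assms(2) by (simp add: field_simps)
  ultimately show ?thesis by simp
qed

lemma is_dickman_unique:
  assumes f: "is_dickman f" and g: "is_dickman g"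
  shows "f = g"
proof -
  have eq: "\<forall>v\<in>{0..real n + 1}. f v = g v" for n
  proof (induction n)
    case 0
    then show ?case using f g by (auto simp: is_dickman_def)
  next
    case (Suc n)
    show ?case
    proof
      fix v assume v: "v \<in> {0..real (Suc n) + 1}"
      show "f v = g v"
      proof (cases "v \<le> real n + 1")
        case True
        then show ?thesis using Suc v by auto
      next
        case False
        have "continuous_on {real n + 1..v} (\<lambda>x. f x - g x)"
          using f g unfolding is_dickman_def
          by (intro continuous_on_diff; meson atLeastAtMost_iff atLeast_iff
              continuous_on_subset of_nat_0_le_iff order_trans subsetI add_nonneg_nonneg zero_le_one)
        moreover have "((\<lambda>x. f x - g x) has_real_derivative 0) (at x)"
          if x: "real n + 1 < x" "x < v" for x
        proof -
          have "f (x - 1) = g (x - 1)" using Suc x v by auto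
          moreover have "x > 1" using x by simp
          ultimately show ?thesis
            using DERIV_diff[OF is_dickman_has_derivative[OF f] is_dickman_has_derivative[OF g], of x]
            by simp
        qed
        ultimately have "f v - g v = f (real n + 1) - g (real n + 1)"
          using False by (intro DERIV_isconst_end[where f = "\<lambda>x. f x - g x"]) auto
        then show ?thesis using Suc by auto
      qed
    qed
  qed
  show ?thesis
  proof
    fix v
    show "f v = g v"
    proof (cases "v < 0")
      case True
      then show ?thesis using f g by (simp add: is_dickman_def)
    next
      case False
      have "v \<le> real (nat \<lceil>v\<rceil>) + 1" by linarith
      then show ?thesis using eq[of "nat \<lceil>v\<rceil>"] False by auto
    qed
  qed
qed

text \<open>
  Approximations for the existence proof: \<open>dickman_approx k\<close> has the required values on \<open>{0..k + 1}\<close>.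
\<close>

primrec dickman_approx :: "nat \<Rightarrow> real \<Rightarrow> real" where
  "dickman_approx 0 v = 1"
| "dickman_approx (Suc k) v = 1 - integral {1..v} (\<lambda>t. dickman_approx k (t - 1) / t)"

lemma dickman_approx_le_1: "v \<le> 1 \<Longrightarrow> dickman_approx k v = 1"
proof (cases k)
  case (Suc j)
  assume "v \<le> 1"
  then consider "v = 1" | "v < 1" by linarith
  then show ?thesis by cases (auto simp: Suc)
qed simp

lemma continuous_dickman_approx: "continuous_on UNIV (dickman_approx k)"
proof (induction k)
  case 0
  have "dickman_approx 0 = (\<lambda>_. 1)" by auto
  then show ?case by simp
next
  case (Suc k)
  have cont: "continuous_on {1..b} (\<lambda>t. dickman_approx k (t - 1) / t)" for b
    by (intro continuous_intros continuous_on_compose2[OF Suc]) auto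
  have "continuous_on {1..b} (dickman_approx (Suc k))" for b
    using indefinite_integral_continuous_1[OF integrable_continuous_real[OF cont], of b]
    by (auto intro!: continuous_intros)
  moreover have "continuous_on {..1} (dickman_approx (Suc k))"
    using continuous_on_const[of "{..1::real}" "1::real"]
    by (rule continuous_on_eq) (simp only: dickman_approx_le_1 atMost_iff)
  moreover have "{..b} = {..1} \<union> {1..b}" if "b \<ge> 1" for b :: real
    using that by auto
  ultimately have c: "continuous_on {..b} (dickman_approx (Suc k))" if "b \<ge> 1" for b
    using that by (metis closed_atMost closed_atLeastAtMost continuous_on_closed_Un)
  have "isCont (dickman_approx (Suc k)) x" for x
  proof -
    have "x \<in> interior {..max 1 (x + 1)}" by auto
    then show ?thesis using continuous_on_interior[OF c[of "max 1 (x + 1)"]] by auto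
  qed
  then show ?case by (simp add: continuous_on_eq_continuous_at del: dickman_approx.simps)
qed

lemma dickman_approx_Suc_eq:
  "v \<le> real k + 1 \<Longrightarrow> dickman_approx (Suc k) v = dickman_approx k v"
proof (induction k arbitrary: v)
  case 0
  then show ?case using dickman_approx_le_1[of v "Suc 0"] by simp
next
  case (Suc k)
  have "integral {1..v} (\<lambda>t. dickman_approx (Suc k) (t - 1) / t) =
        integral {1..v} (\<lambda>t. dickman_approx k (t - 1) / t)"
    using Suc by (intro integral_cong) (auto simp del: dickman_approx.simps)
  then show ?case by (simp only: dickman_approx.simps)
qed

lemma dickman_approx_eq:
  assumes "j \<le> k" "v \<le> real j + 1"
  shows "dickman_approx k v = dickman_approx j v"
  using assms(1)
proof (induction k rule: dec_induct)
  case (step k)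
  then show ?case using assms(2) dickman_approx_Suc_eq[of v k] by (simp del: dickman_approx.simps)
qed simp

lemma dickman_approx_has_derivative:
  assumes "v > 1"
  shows "(dickman_approx (Suc k) has_real_derivative (- dickman_approx k (v - 1) / v)) (at v)"
proof -
  have cont: "continuous_on {1..v + 1} (\<lambda>t. dickman_approx k (t - 1) / t)"
    by (intro continuous_intros continuous_on_compose2[OF continuous_dickman_approx]) auto
  have "((\<lambda>u. integral {1..u} (\<lambda>t. dickman_approx k (t - 1) / t)) has_real_derivative
          dickman_approx k (v - 1) / v) (at v within {1..v + 1})"
    using integral_has_real_derivative[OF cont, of v] assms by auto
  moreover have "at v within {1..v + 1} = at v"
    using assms by (intro at_within_interior) auto
  ultimately have "((\<lambda>u. 1 - integral {1..u} (\<lambda>t. dickman_approx k (t - 1) / t)) has_real_derivative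
          (0 - dickman_approx k (v - 1) / v)) (at v)"
    by (intro DERIV_diff DERIV_const) auto
  then show ?thesis by (simp add: dickman_approx.simps(2)[abs_def])
qed

lemma is_dickman_exists: "\<exists>f. is_dickman f"
proof -
  define f where "f v = (if v < 0 then 0 else dickman_approx (nat \<lceil>v\<rceil>) v)" for v
  have f_eq: "f v = dickman_approx k v" if "0 \<le> v" "v \<le> real k" for v k
  proof -
    have "nat \<lceil>v\<rceil> \<le> k" using that by linarith
    moreover have "v \<le> real (nat \<lceil>v\<rceil>) + 1" by linarith
    ultimately show ?thesis using that dickman_approx_eq[of "nat \<lceil>v\<rceil>" k v] by (simp add: f_def)
  qed
  have der: "(f has_real_derivative (- f (v - 1) / v)) (at v)" if "v > 1" for v
  proof -
    define k where "k = nat \<lceil>v\<rceil>"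
    have k: "v \<le> real k" unfolding k_def by linarith
    have "(dickman_approx (Suc k) has_real_derivative (- dickman_approx k (v - 1) / v)) (at v)"
      by (rule dickman_approx_has_derivative[OF that])
    moreover have "dickman_approx k (v - 1) = f (v - 1)"
      using f_eq[of "v - 1" k] k that by simp
    ultimately have "(dickman_approx (Suc k) has_real_derivative (- f (v - 1) / v)) (at v)"
      by simp
    then show ?thesis
    proof (rule has_field_derivative_transform_within_open[where S = "{0<..<real (Suc k)}"])
      show "dickman_approx (Suc k) x = f x" if "x \<in> {0<..<real (Suc k)}" for x
        using f_eq[of x "Suc k"] that by (simp del: dickman_approx.simps)
    qed (use k that in auto)
  qed
  have one: "f v = 1" if "v \<in> {0..1}" for v
    using that dickman_approx_le_1 by (simp add: f_def)
  have "continuous_on {0..} f"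
  proof -
    have "continuous (at x within {0..}) f" if x: "0 \<le> x" "x < 2" for x
    proof (rule continuous_transform_within[where \<delta> = "2 - x"])
      show "continuous (at x within {0..}) (dickman_approx 2)"
        using continuous_dickman_approx[of 2]
        by (auto intro: continuous_at_imp_continuous_at_within simp: continuous_on_eq_continuous_at)
      show "dickman_approx 2 y = f y" if "y \<in> {0..}" "dist y x < 2 - x" for y
        using f_eq[of y 2] that by (auto simp: dist_real_def)
    qed (use x in auto)
    moreover have "continuous (at x within {0..}) f" if "x \<ge> 2" for x
      using der[of x] that by (auto intro!: continuous_at_imp_continuous_at_within DERIV_isCont)
    ultimately show ?thesis
      unfolding continuous_on_eq_continuous_within by (metis atLeast_iff not_le)
  qed
  moreover have "f differentiable (at v) \<and> v * deriv f v + f (v - 1) = 0" if "v > 1" for v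
    using der[OF that] that DERIV_imp_deriv[OF der[OF that]]
    by (auto simp: real_differentiable_def)
  ultimately have "is_dickman f"
    using one by (auto simp: is_dickman_def f_def simp del: atLeastAtMost_iff)
  then show ?thesis by blast
qed

lemma is_dickman_dickman: "is_dickman dickman"
  unfolding dickman_def
  using is_dickman_exists is_dickman_unique by (metis theI)

end

theory Submission
  imports Defs "HOL-Complex_Analysis.Complex_Analysis" "HOL-Real_Asymp.Real_Asymp"
begin

text \<open>
  Removing the cycle of a point gives \<open>n \<kappa>(n,r) = \<Sum>m<n-r. \<kappa>(m,r)\<close>, so that
  the differences \<open>a\<^sub>m = \<kappa>(m,r) - \<kappa>(m-1,r)\<close> are the Taylor coefficients of the entire function
  \<open>A(z) = exp (- \<Sum>j\<le>r. z^j/j)\<close>, and \<open>exp (- H_r) - \<kappa>(n,r)\<close> is the tail \<open>\<Sum>m>n. a\<^sub>m\<close>.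
  Put \<open>u = n/r\<close>.

  If \<open>u^2 \<le> K r\<close>, the recurrence \<open>m a\<^sub>m = - (a\<^sub>m\<^sub>-\<^sub>1 + \<dots> + a\<^sub>m\<^sub>-\<^sub>r)\<close> is compared with
  \<open>v \<rho>(v) = \<integral>\<rho>\<close> over \<open>[v-1,v]\<close>: the sequence \<open>\<rho>(m/(r+1))\<close> is an exact supersolution, whence
  \<open>a\<^sub>m = O(\<rho>(m/(r+1))/r^2)\<close>, and replacing \<open>r + 1\<close> by \<open>r\<close> costs a bounded factor.

  If \<open>u^2 > K r\<close>, Cauchy's inequality is used on the circle of radius \<open>exp (x/r)\<close> with
  \<open>(exp x - 1)/x = u + 1\<close>. There \<open>\<bar>A\<bar>\<close> is smaller than \<open>exp (\<Sum>j\<le>r. exp (x j/r)/j)\<close> by a factor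
  \<open>exp (- c exp x / x^3)\<close>, because the angles \<open>j \<theta>\<close> cannot all be close to \<open>\<pi>\<close>. For
  \<open>r \<ge> (log n)^4\<close> this gain outweighs the error \<open>exp x / r\<close> of replacing the sum by an integral,
  every power of \<open>n\<close>, and the loss in an elementary lower bound for \<open>\<rho>\<close>.
\<close>

subsection \<open>Permutations without short cycles\<close>

text \<open>Composing with the transposition inserts the new point \<open>a\<close> into the cycle of \<open>b\<close>, right before \<open>b\<close>.\<close>

lemma orbit_transpose_comp:
  assumes p: "p permutes S" and S: "finite S" "a \<notin> S" "b \<in> S"
  defines "q \<equiv> Transposition.transpose a b \<circ> p"
  shows "orbit q a = insert a (orbit p b)"
    and "x \<in> S - orbit p b \<Longrightarrow> orbit q x = orbit p x"
proof -
  have perm: "permutation p" "permutation q"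
    using p S unfolding q_def permutation_permutes
    by (metis, metis S(1) finite_insert insertI1 insertI2 permutes_compose permutes_subset
        permutes_swap_id subset_insertI)
  have pa: "p a = a" using p S(2) by (simp add: permutes_not_in)
  have qa: "q a = b" by (simp add: q_def pa)
  have Osub: "orbit p x \<subseteq> S" if "x \<in> S" for x using permutes_orbit_subset[OF p that] .
  have py: "p y \<noteq> a" if "y \<in> S" for y using p S that by (metis permutes_in_image)
  have qy: "q y = (if p y = b then a else p y)" if "y \<in> S" for y
    using py[OF that] by (auto simp: q_def Transposition.transpose_def)
  have bO: "b \<in> orbit p b" using permutation_self_in_orbit[OF perm(1)] .
  have sub1: "y \<in> insert a (orbit p b)" if "y \<in> orbit q a" for y
    using that
  proof induction
    case base
    then show ?case by (simp add: qa bO)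
  next
    case (step y)
    show ?case
    proof (cases "y = a")
      case True
      then show ?thesis by (simp add: qa bO)
    next
      case False
      then have y: "y \<in> orbit p b" "y \<in> S" using step Osub[OF S(3)] by auto
      then show ?thesis using qy[of y] orbit.step[of y p b] by auto
    qed
  qed
  have aq: "a \<in> orbit q a" using permutation_self_in_orbit[OF perm(2)] .
  have bq: "b \<in> orbit q a" using orbit.base[of q a] by (simp add: qa)
  have key: "p y \<in> orbit q a" if "y \<in> S" "y \<in> orbit q a" for y
    using qy[OF that(1)] orbit.step[OF that(2)] bq by (cases "p y = b") auto
  have sub2: "y \<in> orbit q a" if "y \<in> orbit p b" for y
    using that
  proof induction
    case base
    then show ?case using key[OF S(3) bq] .
  next
    case (step y)
    then show ?case using key Osub[OF S(3)] by auto
  qed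
  show "orbit q a = insert a (orbit p b)" using sub1 sub2 aq by auto
  assume x: "x \<in> S - orbit p b"
  show "orbit q x = orbit p x"
  proof (rule sym, rule orbit_cong0)
    show "x \<in> orbit p x" using permutation_self_in_orbit[OF perm(1)] .
    show "p \<in> orbit p x \<rightarrow> orbit p x" by (auto intro: orbit.step)
    fix y assume y: "y \<in> orbit p x"
    then have yS: "y \<in> S" using Osub x by auto
    have "p y \<noteq> b"
    proof
      assume "p y = b"
      then have "b \<in> orbit p x" using orbit.step[OF y] by simp
      then have "x \<in> orbit p b"
        using orbit_swap permutation_self_in_orbit[OF perm(1)] by metis
      then show False using x by simp
    qed
    then show "p y = q y" using qy[OF yS] by simp
  qed
qed

section \<open>Counting by the cycle through a marked point\<close>

definition long_cycles :: "nat \<Rightarrow> 'a set \<Rightarrow> ('a \<Rightarrow> 'a) set" where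
  "long_cycles r S = {p. p permutes S \<and> (\<forall>x\<in>S. r < card (orbit p x))}"

text \<open>The cycle of \<open>a\<close> is exempt from the length condition, because the induction
  on \<open>k\<close> shortens it point by point, also below the threshold \<open>r\<close>.\<close>

definition long_cycles_but :: "nat \<Rightarrow> 'a set \<Rightarrow> 'a \<Rightarrow> nat \<Rightarrow> ('a \<Rightarrow> 'a) set" where
  "long_cycles_but r S a k =
     {p. p permutes S \<and> card (orbit p a) = k \<and> (\<forall>x\<in>S - orbit p a. r < card (orbit p x))}"

lemma finite_long_cycles [simp]:
  "finite S \<Longrightarrow> finite (long_cycles r S)" "finite S \<Longrightarrow> finite (long_cycles_but r S a k)"
proof -
  assume S: "finite S"
  show "finite (long_cycles r S)"
    by (rule finite_subset[OF _ finite_permutations[OF S]]) (auto simp: long_cycles_def)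
  show "finite (long_cycles_but r S a k)"
    by (rule finite_subset[OF _ finite_permutations[OF S]]) (auto simp: long_cycles_but_def)
qed

lemma card_orbit_bounds:
  assumes "p permutes S" "finite S" "a \<in> S"
  shows "1 \<le> card (orbit p a)" "card (orbit p a) \<le> card S"
proof -
  have "orbit p a \<subseteq> S" using assms permutes_orbit_subset by metis
  then show "1 \<le> card (orbit p a)" "card (orbit p a) \<le> card S"
    using assms(2) orbit_nonempty[of p a]
    by (auto simp: card_mono Suc_le_eq card_gt_0_iff finite_subset)
qed

lemma long_cycles_but_one:
  assumes "finite S" "a \<notin> S"
  shows "long_cycles_but r (insert a S) a 1 = long_cycles r S"
proof -
  have *: "orbit p a = {a}" if "p a = a" for p using that by (simp add: orbit_eq_singleton_iff)
  have "p \<in> long_cycles_but r (insert a S) a 1 \<longleftrightarrow> p \<in> long_cycles r S" for p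
  proof
    assume p: "p \<in> long_cycles_but r (insert a S) a 1"
    then have pp: "p permutes insert a S" and c: "card (orbit p a) = 1"
      and l: "\<forall>x\<in>insert a S - orbit p a. r < card (orbit p x)"
      by (auto simp: long_cycles_but_def)
    have "a \<in> orbit p a" using pp assms permutation_self_in_orbit permutation_permutes finite_insert
      by metis
    then have o: "orbit p a = {a}" using c by (metis card_1_singletonE singletonD)
    then have "p a = a" by (simp add: orbit_eq_singleton_iff)
    then have "p permutes S" using pp by (metis permutes_superset DiffE insertE Diff_iff)
    then show "p \<in> long_cycles r S" using l o assms by (auto simp: long_cycles_def)
  next
    assume p: "p \<in> long_cycles r S"
    then have pp: "p permutes S" by (simp add: long_cycles_def)
    then have "p a = a" using assms by (simp add: permutes_not_in)
    then show "p \<in> long_cycles_but r (insert a S) a 1"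
      using p pp * permutes_subset[OF pp, of "insert a S"]
      by (auto simp: long_cycles_def long_cycles_but_def)
  qed
  then show ?thesis by blast
qed

text \<open>Deleting \<open>a\<close> from its cycle is a bijection onto the pairs of the image
  \<open>b\<close> of \<open>a\<close> and a permutation of \<open>S\<close> whose cycle through
  \<open>b\<close> has length \<open>k\<close>. All other cycles stay as they are;
  \<open>k \<ge> 1\<close> says that \<open>a\<close> is not a fixed point.\<close>

lemma card_long_cycles_but_Suc:
  assumes S: "finite S" "a \<notin> S" and k: "k \<ge> 1"
  shows "card (long_cycles_but r (insert a S) a (Suc k)) = (\<Sum>b\<in>S. card (long_cycles_but r S b k))"
proof -
  define h where "h = (\<lambda>(b, p::'a \<Rightarrow> 'a). Transposition.transpose a b \<circ> p)"
  have fin: "finite (orbit p b)" if "p permutes S" "b \<in> S" for p b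
    using permutes_orbit_subset[OF that] S(1) finite_subset by blast
  have iff: "h (b, p) \<in> long_cycles_but r (insert a S) a (Suc k) \<longleftrightarrow> p \<in> long_cycles_but r S b k"
    if p: "p permutes S" and b: "b \<in> S" for p b
  proof -
    have "h (b, p) permutes insert a S" unfolding h_def using p b
      by (auto intro!: permutes_compose[OF permutes_subset] permutes_swap_id)
    moreover have "a \<notin> orbit p b" using permutes_orbit_subset[OF p b] S by auto
    ultimately show ?thesis
      using orbit_transpose_comp[OF p S b] fin[OF p b] p S
      by (auto simp: h_def long_cycles_but_def)
  qed
  have "long_cycles_but r (insert a S) a (Suc k) = h ` (SIGMA b:S. long_cycles_but r S b k)"
  proof (intro equalityI subsetI)
    fix q assume q: "q \<in> long_cycles_but r (insert a S) a (Suc k)"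
    then have "q permutes insert a S" by (simp add: long_cycles_but_def)
    then have "q \<in> h ` {(b, p). b \<in> insert a S \<and> p \<in> {p. p permutes S}}"
      unfolding h_def permutes_insert[symmetric] by simp
    then obtain b p where bp: "q = h (b, p)" "b \<in> insert a S" "p permutes S" by blast
    have "b \<noteq> a"
    proof
      assume "b = a"
      then have "q a = a" using bp S by (simp add: h_def permutes_not_in)
      then have "orbit q a = {a}" by (simp add: orbit_eq_singleton_iff)
      then show False using q k by (simp add: long_cycles_but_def)
    qed
    then have "b \<in> S" using bp by auto
    then show "q \<in> h ` (SIGMA b:S. long_cycles_but r S b k)" using iff[OF bp(3)] bp q by blast
  next
    fix q assume "q \<in> h ` (SIGMA b:S. long_cycles_but r S b k)"
    then show "q \<in> long_cycles_but r (insert a S) a (Suc k)"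
      using iff by (auto simp: long_cycles_but_def)
  qed
  moreover have "inj_on h (SIGMA b:S. long_cycles_but r S b k)"
  proof (rule inj_onI, clarsimp)
    fix b p c q
    assume bp: "b \<in> S" "p \<in> long_cycles_but r S b k" "c \<in> S" "q \<in> long_cycles_but r S c k"
      and eq: "h (b, p) = h (c, q)"
    have "p a = a" "q a = a" using bp S by (auto simp: long_cycles_but_def permutes_not_in)
    then have bc: "b = c" using fun_cong[OF eq, of a] by (simp add: h_def)
    have "p x = q x" for x using fun_cong[OF eq, of x] unfolding h_def bc
      by (simp only: prod.case o_apply) (metis transpose_involutory)
    then show "b = c \<and> p = q" using bc by auto
  qed
  ultimately show ?thesis using S by (simp add: card_image)
qed

text \<open>Deleting the marked point repeatedly contributes \<open>card S - 1\<close>,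
  \<open>card S - 2\<close>, ... choices until the cycle is used up; the remaining
  \<open>card S - k\<close> points carry only long cycles. The assumption on \<open>f\<close> serves
  as the induction hypothesis of a later strong induction on cardinality.\<close>

lemma card_long_cycles_but:
  fixes f :: "nat \<Rightarrow> real" and S :: "'a set"
  assumes "\<And>T :: 'a set. finite T \<Longrightarrow> card T < card S \<Longrightarrow> real (card (long_cycles r T)) = f (card T)"
    and "finite S" "a \<in> S" "1 \<le> k" "k \<le> card S"
  shows "real (card (long_cycles_but r S a k)) = fact (card S - 1) / fact (card S - k) * f (card S - k)"
  using assms(4,1-3,5)
proof (induction k arbitrary: S a rule: dec_induct)
  case base
  define T where "T = S - {a}"
  have T: "S = insert a T" "a \<notin> T" "finite T" "card S = Suc (card T)"
    using base by (simp_all add: T_def insert_absorb)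
  have "real (card (long_cycles_but r S a 1)) = real (card (long_cycles r T))"
    using long_cycles_but_one[OF T(3,2), of r] T(1) by simp
  also have "\<dots> = f (card T)" using base(1)[of T] T by simp
  finally show ?case by (simp add: T(4))
next
  case (step k)
  define T where "T = S - {a}"
  have T: "S = insert a T" "a \<notin> T" "finite T" "card S = Suc (card T)"
    using step by (simp_all add: T_def insert_absorb)
  have IH: "real (card (long_cycles_but r T b k)) =
      fact (card T - 1) / fact (card T - k) * f (card T - k)" if "b \<in> T" for b
    using step T that by (intro step.IH) auto
  have "real (card (long_cycles_but r S a (Suc k))) = (\<Sum>b\<in>T. real (card (long_cycles_but r T b k)))"
    using card_long_cycles_but_Suc[OF T(3,2) step(1), of r] T(1) by simp
  also have "\<dots> = real (card T) * (fact (card T - 1) / fact (card T - k) * f (card T - k))"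
    using IH by simp
  also have "\<dots> = fact (card T) / fact (card T - k) * f (card T - k)"
    using step T by (subst (2) fact_reduce) auto
  finally show ?case by (simp add: T(4))
qed

text \<open>The permutations are split by the length \<open>k\<close> of the cycle through one
  chosen point, which must exceed \<open>r\<close>.\<close>

lemma card_long_cycles_rec:
  fixes f :: "nat \<Rightarrow> real" and S :: "'a set"
  assumes f: "\<And>T :: 'a set. finite T \<Longrightarrow> card T < card S \<Longrightarrow> real (card (long_cycles r T)) = f (card T)"
    and S: "finite S" "S \<noteq> {}"
  shows "real (card (long_cycles r S)) =
    (\<Sum>k=r+1..card S. fact (card S - 1) / fact (card S - k) * f (card S - k))"
proof -
  obtain a where a: "a \<in> S" using S by auto
  have sub: "long_cycles r S = (\<Union>k\<in>{r+1..card S}. long_cycles_but r S a k)"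
  proof (intro equalityI subsetI)
    fix p assume "p \<in> long_cycles r S"
    then show "p \<in> (\<Union>k\<in>{r+1..card S}. long_cycles_but r S a k)"
      using card_orbit_bounds[of p S a] S a
      by (auto simp: long_cycles_def long_cycles_but_def)
  next
    fix p assume "p \<in> (\<Union>k\<in>{r+1..card S}. long_cycles_but r S a k)"
    then have p: "p permutes S" "r < card (orbit p a)"
      "\<forall>x\<in>S - orbit p a. r < card (orbit p x)"
      by (auto simp: long_cycles_but_def)
    have perm: "permutation p" using p S permutation_permutes by auto
    have "r < card (orbit p x)" if "x \<in> S" for x
    proof (cases "x \<in> orbit p a")
      case True
      then have "orbit p x = orbit p a"
        using cyclic_on_orbit'[OF perm] orbit_cyclic_eq3 by metis
      then show ?thesis using p by simp
    qed (use p that in auto)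
    then show "p \<in> long_cycles r S" using p by (simp add: long_cycles_def)
  qed
  have "card (long_cycles r S) = (\<Sum>k=r+1..card S. card (long_cycles_but r S a k))"
    unfolding sub
  proof (rule card_UN_disjoint)
    show "\<forall>k\<in>{r+1..card S}. finite (long_cycles_but r S a k)" using S by simp
  qed (auto simp: long_cycles_but_def)
  then show ?thesis
    using card_long_cycles_but[OF f S(1) a] by (simp add: atLeastAtMost_iff)
qed

text \<open>By strong induction the recursion has the same right-hand side for both sets. The sets
  consist of naturals so that \<open>{1..card U}\<close> can serve as the reference set that defines
  \<open>f\<close>.\<close>

lemma card_long_cycles_cong:
  assumes "finite S" "finite T" "card S = card T"
  shows "card (long_cycles r (S::nat set)) = card (long_cycles r (T::nat set))"
  using assms
proof (induction "card S" arbitrary: S T rule: less_induct)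
  case less
  define f where "f n = real (card (long_cycles r {1..n::nat}))" for n
  have f: "real (card (long_cycles r U)) = f (card U)" if "finite U" "card U < card S" for U :: "nat set"
    using less.hyps[of U "{1..card U}"] that by (simp add: f_def)
  show ?case
  proof (cases "S = {}")
    case True
    then show ?thesis using less by auto
  next
    case False
    then have "T \<noteq> {}" using less by auto
    have "real (card (long_cycles r S)) = real (card (long_cycles r T))"
      using card_long_cycles_rec[of S r f] card_long_cycles_rec[of T r f] f less(2-4) False \<open>T \<noteq> {}\<close>
      by simp
    then show ?thesis by simp
  qed
qed

section \<open>From counts to probabilities\<close>

lemma kappa_conv_card: "kappa n r = card (long_cycles r {1..n}) / fact n"
proof -
  have fin: "finite {p. p permutes {1..n}}" by (simp add: finite_permutations)
  have ne: "{p. p permutes {1..n}} \<noteq> {}" using permutes_id[of "{1..n}"] by blast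
  have "{p. p permutes {1..n}} \<inter> {p. \<forall>c\<in>cycles_on p {1..n}. r < card c} = long_cycles r {1..n}"
    by (auto simp: cycles_on_def long_cycles_def)
  moreover have "card {p. p permutes {1..n}} = fact n" by (rule card_permutations) auto
  ultimately show ?thesis unfolding kappa_def measure_pmf_of_set[OF ne fin] by simp
qed

lemma kappa_0 [simp]: "kappa 0 r = 1"
proof -
  have "long_cycles r {1..0::nat} = {id}" by (auto simp: long_cycles_def)
  then show ?thesis unfolding kappa_conv_card by simp
qed

text \<open>The factorials cancel on dividing by \<open>fact n\<close>, and \<open>m = n - k\<close>
  reindexes the sum. Truncated subtraction makes the sum empty for \<open>n \<le> r\<close>, which
  encodes \<open>kappa n r = 0\<close> for \<open>1 \<le> n \<le> r\<close>.\<close>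

lemma kappa_rec: "real n * kappa n r = (\<Sum>m<n - r. kappa m r)"
proof (cases "n = 0")
  case False
  define f where "f m = real (card (long_cycles r {1..m::nat}))" for m
  have fT: "real (card (long_cycles r T)) = f (card T)" if "finite T" for T :: "nat set"
    using card_long_cycles_cong[OF that, of "{1..card T}" r] by (simp add: f_def)
  have "f n = (\<Sum>k=r+1..n. fact (n - 1) / fact (n - k) * f (n - k))"
    using card_long_cycles_rec[of "{1..n}" r f, OF fT] False by (simp add: f_def)
  also have "\<dots> = (\<Sum>k=r+1..n. fact (n - 1) * kappa (n - k) r)"
    by (simp add: kappa_conv_card f_def)
  also have "\<dots> = fact (n - 1) * (\<Sum>k=r+1..n. kappa (n - k) r)"
    by (simp add: sum_distrib_left)
  also have "(\<Sum>k=r+1..n. kappa (n - k) r) = (\<Sum>m<n - r. kappa m r)"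
    by (rule sum.reindex_bij_witness[of _ "\<lambda>m. n - m" "\<lambda>k. n - k"]) auto
  finally have "f n = fact (n - 1) * (\<Sum>m<n - r. kappa m r)" .
  moreover have "fact n = real n * fact (n - 1)" using False by (simp add: fact_reduce)
  moreover have "kappa n r = f n / fact n" by (simp add: kappa_conv_card f_def)
  ultimately show ?thesis using False by simp
qed simp

subsection \<open>The generating function\<close>

text \<open>The recurrences for \<open>n\<close> and \<open>Suc n\<close> differ by the single term
  \<open>kappa (n - r) r\<close>, and \<open>kappa n r - kappa (n - r) r\<close> telescopes.\<close>

lemma kappa_diff:
  assumes "r \<le> n"
  shows "real (Suc n) * (kappa (Suc n) r - kappa n r) =
         - (\<Sum>i=n-r..<n. kappa (Suc i) r - kappa i r)"
proof -
  have "(\<Sum>m<Suc n - r. kappa m r) = (\<Sum>m<n - r. kappa m r) + kappa (n - r) r"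
    using assms by (simp add: Suc_diff_le)
  then have "real (Suc n) * kappa (Suc n) r = real n * kappa n r + kappa (n - r) r"
    using kappa_rec[of n r] kappa_rec[of "Suc n" r] by simp
  moreover have "(\<Sum>i=n-r..<n. kappa (Suc i) r - kappa i r) = kappa n r - kappa (n - r) r"
    by (rule sum_Suc_diff') simp
  ultimately show ?thesis by (simp add: algebra_simps)
qed

text \<open>Formally \<open>(1 - z) * exp (\<Sum>j>r. z^j/j)\<close>, that is, \<open>1 - z\<close>
  times the generating function of \<open>kappa\<close>.\<close>

definition short_gf :: "nat \<Rightarrow> complex \<Rightarrow> complex" where
  "short_gf r z = exp (- (\<Sum>j=1..r. z ^ j / of_nat j))"

lemma holomorphic_short_gf: "short_gf r holomorphic_on A"
  unfolding short_gf_def by (intro holomorphic_intros) auto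

lemma deriv_short_gf: "deriv (short_gf r) z = - short_gf r z * (\<Sum>j<r. z ^ j)"
proof -
  have "((\<lambda>z. \<Sum>j=1..r. z ^ j / of_nat j) has_field_derivative (\<Sum>j=1..r. z ^ (j - 1))) (at z)"
    by (auto intro!: derivative_eq_intros sum.cong)
  moreover have "(\<Sum>j=1..r. z ^ (j - 1)) = (\<Sum>j<r. z ^ j)"
    by (rule sum.reindex_bij_witness[of _ Suc "\<lambda>j. j - 1"]) auto
  ultimately have "((\<lambda>z. \<Sum>j=1..r. z ^ j / of_nat j) has_field_derivative (\<Sum>j<r. z ^ j)) (at z)"
    by (simp only:)
  then have "(short_gf r has_field_derivative - short_gf r z * (\<Sum>j<r. z ^ j)) (at z)"
    using DERIV_chain2[OF DERIV_exp DERIV_minus] unfolding short_gf_def[abs_def] by fastforce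
  then show ?thesis by (rule DERIV_imp_deriv)
qed

text \<open>Coefficients are compared in \<open>A' = - A * (1 + z + ... + z^(r-1))\<close>. The test
  \<open>n < r + i\<close> is \<open>n - i < r\<close> without truncated subtraction.\<close>

lemma short_gf_coeff_rec:
  fixes r defines "F \<equiv> fps_expansion (short_gf r) 0"
  shows "of_nat (Suc n) * fps_nth F (Suc n) = - (\<Sum>i\<le>n. if n < r + i then fps_nth F i else 0)"
proof -
  have F: "short_gf r has_fps_expansion F"
    unfolding F_def using holomorphic_short_gf[of r UNIV] by blast
  have "deriv (short_gf r) has_fps_expansion - F * (\<Sum>j<r. fps_X ^ j)"
    unfolding deriv_short_gf[abs_def] by (intro fps_expansion_intros F)
  then have "fps_deriv F = - F * (\<Sum>j<r. fps_X ^ j)"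
    using has_fps_expansion_deriv[OF F] fps_expansion_unique_complex by blast
  then have "fps_nth (fps_deriv F) n = fps_nth (- F * (\<Sum>j<r. fps_X ^ j)) n" by simp
  moreover have "fps_nth (\<Sum>j<r. fps_X ^ j :: complex fps) i = (if i < r then 1 else 0)" for i
    by (simp add: fps_sum_nth fps_X_power_nth)
  ultimately show ?thesis
    by (simp add: fps_mult_nth atLeast0AtMost sum_negf[symmetric] if_distrib cong: if_cong)
       (auto intro!: sum.cong)
qed

text \<open>The partial sums obey the recurrence and the initial value of \<open>kappa\<close>,
  which determine the sequence.\<close>

lemma sum_short_gf_coeff:
  "(\<Sum>i\<le>n. fps_nth (fps_expansion (short_gf r) 0) i) = of_real (kappa n r)"
proof -
  define c where "c = fps_nth (fps_expansion (short_gf r) 0)"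
  define S where "S n = (\<Sum>i\<le>n. c i)" for n
  have rec: "of_nat n * S n = (\<Sum>m<n - r. S m)" for n
  proof (induction n)
    case (Suc n)
    have "of_nat (Suc n) * S (Suc n) = of_nat n * S n + S n + of_nat (Suc n) * c (Suc n)"
      by (simp add: S_def algebra_simps)
    also have "of_nat (Suc n) * c (Suc n) = - (\<Sum>i\<le>n. if n < r + i then c i else 0)"
      unfolding c_def by (rule short_gf_coeff_rec)
    \<comment> \<open>Against \<open>S n\<close>, the window cancels and only the coefficients with
      \<open>r + i \<le> n\<close> survive.\<close>
    also have "of_nat n * S n + S n + - (\<Sum>i\<le>n. if n < r + i then c i else 0) =
        of_nat n * S n + (\<Sum>i\<le>n. if n < r + i then 0 else c i)"
      by (simp add: S_def sum_subtractf[symmetric]) (auto intro!: sum.cong)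
    also have "(\<Sum>i\<le>n. if n < r + i then 0 else c i) = (if r \<le> n then S (n - r) else 0)"
    proof (cases "r \<le> n")
      case True
      have "(\<Sum>i\<le>n. if n < r + i then 0 else c i) = (\<Sum>i\<le>n - r. c i)"
        by (rule sum.mono_neutral_cong_right) (use True in auto)
      then show ?thesis using True by (simp add: S_def)
    qed auto
    finally show ?case by (auto simp: Suc.IH Suc_diff_le)
  qed simp
  have "S n = of_real (kappa n r)"
  proof (induction n rule: less_induct)
    case (less n)
    show ?case
    proof (cases "n = 0")
      case True
      then show ?thesis by (simp add: S_def c_def fps_expansion_def short_gf_def power_0_left)
    next
      case False
      have "of_nat n * S n = of_real (\<Sum>m<n - r. kappa m r)"
        unfolding rec of_real_sum by (rule sum.cong) (use less False in auto)
      also have "\<dots> = of_nat n * of_real (kappa n r)"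
        unfolding kappa_rec[symmetric] by simp
      finally show ?thesis using False by simp
    qed
  qed
  then show ?thesis by (simp add: S_def c_def)
qed

text \<open>The Taylor series of the entire function is evaluated at 1, inside the disc of radius 2;
  its partial sums are the values of \<open>kappa\<close>.\<close>

lemma kappa_tendsto: "(\<lambda>n. kappa n r) \<longlonglongrightarrow> exp (- harm r)"
proof -
  have "(\<lambda>n. (deriv ^^ n) (short_gf r) 0 / fact n * (1 - 0) ^ n) sums short_gf r 1"
    by (rule holomorphic_power_series[OF holomorphic_short_gf, of _ _ 2]) auto
  then have "(\<lambda>n. \<Sum>i\<le>n. fps_nth (fps_expansion (short_gf r) 0) i) \<longlonglongrightarrow> short_gf r 1"
    unfolding sums_def_le by (simp add: fps_expansion_def)
  moreover have "short_gf r 1 = of_real (exp (- harm r))"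
    by (simp add: short_gf_def harm_def exp_of_real[symmetric] inverse_eq_divide)
  ultimately have "(\<lambda>n. complex_of_real (kappa n r)) \<longlonglongrightarrow> of_real (exp (- harm r))"
    by (simp add: sum_short_gf_coeff)
  then show ?thesis by (simp add: tendsto_of_real_iff)
qed

lemma kappa_diff_Cauchy:
  assumes "R > 0" and M: "\<And>z. norm z = R \<Longrightarrow> norm (short_gf r z) \<le> M"
  shows "\<bar>kappa (Suc n) r - kappa n r\<bar> \<le> M / R ^ Suc n"
proof -
  have "complex_of_real (kappa (Suc n) r - kappa n r) =
      (deriv ^^ Suc n) (short_gf r) 0 / fact (Suc n)"
    by (simp add: sum_short_gf_coeff[symmetric] fps_expansion_def)
  then have "\<bar>kappa (Suc n) r - kappa n r\<bar> = norm ((deriv ^^ Suc n) (short_gf r) 0) / fact (Suc n)"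
    by (metis norm_divide norm_fact norm_of_real)
  also have "\<dots> \<le> (fact (Suc n) * M / R ^ Suc n) / fact (Suc n)"
    by (intro divide_right_mono Cauchy_inequality holomorphic_short_gf
        holomorphic_on_imp_continuous_on assms) auto
  finally show ?thesis by simp
qed

text \<open>\<open>N\<close> tends to infinity in the telescoped difference; a uniform bound on
  finite sums takes the place of summability.\<close>

lemma kappa_minus_limit_le:
  assumes b: "\<And>N. (\<Sum>i=n..<N. \<bar>kappa (Suc i) r - kappa i r\<bar>) \<le> B"
  shows "\<bar>kappa n r - exp (- harm r)\<bar> \<le> B"
proof (rule Lim_bounded[of "\<lambda>N. \<bar>kappa n r - kappa N r\<bar>"])
  show "(\<lambda>N. \<bar>kappa n r - kappa N r\<bar>) \<longlonglongrightarrow> \<bar>kappa n r - exp (- harm r)\<bar>"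
    by (intro tendsto_intros kappa_tendsto)
  show "\<forall>N\<ge>n. \<bar>kappa n r - kappa N r\<bar> \<le> B"
  proof (intro allI impI)
    fix N assume "n \<le> N"
    then have "kappa N r - kappa n r = (\<Sum>i=n..<N. kappa (Suc i) r - kappa i r)"
      by (rule sum_Suc_diff'[symmetric])
    then have "\<bar>kappa N r - kappa n r\<bar> \<le> (\<Sum>i=n..<N. \<bar>kappa (Suc i) r - kappa i r\<bar>)"
      by (metis sum_abs)
    then show "\<bar>kappa n r - kappa N r\<bar> \<le> B" using b[of N] by linarith
  qed
qed

subsection \<open>Dickman's function\<close>

lemma continuous_dickman: "A \<subseteq> {0..} \<Longrightarrow> continuous_on A dickman"
  using is_dickman_dickman continuous_on_subset unfolding is_dickman_def by blast

lemma dickman_eq_1: "0 \<le> v \<Longrightarrow> v \<le> 1 \<Longrightarrow> dickman v = 1"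
  using is_dickman_dickman unfolding is_dickman_def by auto

lemma dickman_has_derivative:
  "v > 1 \<Longrightarrow> (dickman has_real_derivative (- dickman (v - 1) / v)) (at v)"
  using is_dickman_has_derivative[OF is_dickman_dickman] .

lemma dickman_integrable: "0 \<le> a \<Longrightarrow> dickman integrable_on {a..b}"
  by (intro integrable_continuous_real continuous_dickman) auto

lemma integral_dickman_diff:
  assumes "0 \<le> a" "a \<le> b"
  shows "integral {0..b} dickman - integral {0..a} dickman = integral {a..b} dickman"
  using Henstock_Kurzweil_Integration.integral_combine[OF assms dickman_integrable] by simp

text \<open>By the delay equation the difference of the two sides has derivative zero for
  \<open>u > 1\<close>, and it vanishes at 1.\<close>

lemma dickman_integral_eq:
  assumes "u \<ge> 1"
  shows "integral {u - 1..u} dickman = u * dickman u"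
proof -
  define G where "G x = integral {0..x} dickman" for x
  have G: "(G has_real_derivative dickman x) (at x)" if "x > 0" for x
  proof -
    have "(G has_real_derivative dickman x) (at x within {0..x + 1})"
      unfolding G_def using that
      by (intro integral_has_real_derivative continuous_dickman) auto
    moreover have "at x within {0..x + 1} = at x" using that by (intro at_within_interior) auto
    ultimately show ?thesis by simp
  qed
  have contG: "continuous_on {0..b} G" for b
    unfolding G_def by (intro indefinite_integral_continuous_1 dickman_integrable) auto
  define F where "F x = x * dickman x - (G x - G (x - 1))" for x
  have "F u = F 1"
  proof (cases "u = 1")
    case False
    show ?thesis
    proof (rule DERIV_isconst_end[where f = F])
      show "continuous_on {1..u} F" unfolding F_def
        by (intro continuous_intros continuous_dickman continuous_on_subset[OF contG[of u]]
            continuous_on_compose2[OF contG[of u]]) auto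
      show "(F has_real_derivative 0) (at x)" if "1 < x" "x < u" for x
        unfolding F_def[abs_def] using that
        by (auto intro!: derivative_eq_intros dickman_has_derivative DERIV_chain2[OF G] G)
    qed (use assms False in auto)
  qed simp
  also have "F 1 = 0"
  proof -
    have "G 1 = integral {0..1::real} (\<lambda>_. 1::real)"
      unfolding G_def by (rule Henstock_Kurzweil_Integration.integral_cong) (auto simp: dickman_eq_1)
    then show ?thesis by (simp add: F_def dickman_eq_1) (simp add: G_def)
  qed
  finally show ?thesis using integral_dickman_diff[of "u - 1" u] assms by (simp add: F_def G_def)
qed

text \<open>At the first point where \<open>g\<close> catches up, the two integral relations contradict each other.\<close>

lemma dickman_gt_subsolution:
  assumes cont: "continuous_on {0..} g"
    and init: "\<And>u. 0 \<le> u \<Longrightarrow> u \<le> 1 \<Longrightarrow> g u < 1"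
    and sub: "\<And>u. 1 \<le> u \<Longrightarrow> u * g u \<le> integral {u - 1..u} g"
    and u: "0 \<le> u"
  shows "g u < dickman u"
proof (rule ccontr)
  assume neg: "\<not> g u < dickman u"
  define h where "h x = dickman x - g x" for x
  have conth: "continuous_on A h" if "A \<subseteq> {0..}" for A
    unfolding h_def using that
    by (intro continuous_intros continuous_dickman continuous_on_subset[OF cont])
  define Z where "Z = {0..} \<inter> h -` {..0}"
  have "closed Z" unfolding Z_def
    by (intro continuous_closed_preimage conth) auto
  moreover have uZ: "u \<in> Z" using neg u by (simp add: Z_def h_def)
  moreover have bdd: "bdd_below Z" by (rule bdd_belowI[of _ 0]) (auto simp: Z_def)
  ultimately have vZ: "Inf Z \<in> Z" using closed_contains_Inf by blast
  define v where "v = Inf Z"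
  have hv: "h v \<le> 0" and v0: "v \<ge> 0" using vZ by (auto simp: Z_def v_def)
  have pos: "h x > 0" if "0 \<le> x" "x < v" for x
    using cInf_lower[OF _ bdd, of x] that by (force simp: Z_def v_def)
  have v1: "v > 1" using hv init[of v] v0 by (cases "v \<le> 1") (auto simp: h_def dickman_eq_1)
  have int: "integral {v - 1..v} h = integral {v - 1..v} dickman - integral {v - 1..v} g"
    unfolding h_def using v1
    by (intro integral_diff integrable_continuous_real continuous_dickman
        continuous_on_subset[OF cont]) auto
  have hint: "h integrable_on {v - 1..v}"
    using v1 by (intro integrable_continuous_real conth) auto
  have "integral {v - 1..v} h \<le> v * h v"
    using int dickman_integral_eq[of v] sub[of v] v1 by (simp add: h_def algebra_simps)
  also have "\<dots> \<le> 0" using hv v1 by (simp add: mult_nonneg_nonpos)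
  finally have le: "integral {v - 1..v} h \<le> 0" .
  have nn: "0 \<le> h x" if "x \<in> {v - 1<..<v}" for x using pos[of x] that v1 by auto
  have "0 \<le> integral {v - 1..v} h"
    using nn integral_open_interval_real[of "v - 1" v h] hint
    by (metis integrable_on_open_interval_real integral_nonneg)
  with le hint have z: "(h has_integral 0) (cbox (v - 1) v)" by (simp add: has_integral_iff)
  \<comment> \<open>A nonnegative continuous function with integral zero vanishes on the whole
    interval; the midpoint lies strictly before the first contact point \<open>v\<close>.\<close>
  have "h (v - 1/2) = 0"
    by (rule has_integral_0_cbox_imp_0[OF _ _ z]) (use nn conth v1 in \<open>auto intro!: conth\<close>)
  then show False using pos[of "v - 1/2"] v1 by simp
qed

text \<open>The zero function is a subsolution.\<close>

lemma dickman_pos: "0 \<le> u \<Longrightarrow> 0 < dickman u"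
  using dickman_gt_subsolution[of "\<lambda>_. 0"] by auto

lemma dickman_antimono:
  assumes "0 \<le> u" "u \<le> v"
  shows "dickman v \<le> dickman u"
proof -
  have ge1: "dickman v \<le> dickman u" if "1 \<le> u" "u \<le> v" for u v
  proof (rule DERIV_nonpos_imp_decreasing_open[OF \<open>u \<le> v\<close>])
    show "continuous_on {u..v} dickman" using that by (intro continuous_dickman) auto
    fix x assume "u < x" "x < v"
    then show "\<exists>y. (dickman has_real_derivative y) (at x) \<and> y \<le> 0"
      using that dickman_has_derivative[of x] dickman_pos[of "x - 1"]
      by (intro exI[of _ "- dickman (x - 1) / x"]) auto
  qed
  show ?thesis
    using assms ge1[of u v] ge1[of 1 v] dickman_eq_1[of u] dickman_eq_1[of v] dickman_eq_1[of 1]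
    by (cases "1 \<le> u"; cases "1 \<le> v") auto
qed

section \<open>How fast Dickman's function decays\<close>

lemma integral_dickman_bounds:
  assumes "0 \<le> a" "a \<le> b"
  shows "(b - a) * dickman b \<le> integral {a..b} dickman"
    and "integral {a..b} dickman \<le> (b - a) * dickman a"
proof -
  have "integral {a..b} (\<lambda>_. dickman b) \<le> integral {a..b} dickman"
    using assms by (intro integral_le dickman_integrable) (auto intro: dickman_antimono)
  then show "(b - a) * dickman b \<le> integral {a..b} dickman" using assms by simp
  have "integral {a..b} dickman \<le> integral {a..b} (\<lambda>_. dickman a)"
    using assms by (intro integral_le dickman_integrable) (auto intro: dickman_antimono)
  then show "integral {a..b} dickman \<le> (b - a) * dickman a" using assms by simp
qed

lemma dickman_le_half:
  assumes "1 \<le> t"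
  shows "dickman (t + 1) \<le> dickman t / 2"
proof -
  have "(t + 1) * dickman (t + 1) \<le> dickman t"
    using dickman_integral_eq[of "t + 1"] integral_dickman_bounds(2)[of t "t + 1"] assms by simp
  moreover have "2 * dickman (t + 1) \<le> (t + 1) * dickman (t + 1)"
    using assms dickman_pos[of "t + 1"] by (intro mult_right_mono) auto
  ultimately show ?thesis by simp
qed

text \<open>In \<open>u * dickman u = integral {u - 1..u} dickman\<close> only the first half of the
  interval is kept, where the integrand is at least \<open>dickman (u - 1/2)\<close>.\<close>

lemma dickman_shift_half:
  assumes "1 \<le> u"
  shows "dickman (u - 1/2) \<le> 2 * u * dickman u"
proof -
  have "u * dickman u = integral {u - 1..u} dickman" using dickman_integral_eq[OF assms] by simp
  also have "\<dots> \<ge> integral {u - 1..u - 1/2} dickman"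
    using assms
    by (intro integral_subset_le dickman_integrable) (auto intro!: less_imp_le[OF dickman_pos])
  moreover have "integral {u - 1..u - 1/2} dickman \<ge> 1/2 * dickman (u - 1/2)"
    using integral_dickman_bounds(1)[of "u - 1" "u - 1/2"] assms by simp
  ultimately show ?thesis by simp
qed

lemma dickman_shift_one:
  assumes "1 \<le> u"
  shows "dickman (u - 1) \<le> 4 * u\<^sup>2 * dickman u"
proof -
  have "dickman (u - 1) \<le> 2 * u * dickman (u - 1/2)"
  proof (cases "u \<le> 3/2")
    case True
    then show ?thesis using assms by (simp add: dickman_eq_1)
  next
    case False
    then have "dickman (u - 1) \<le> 2 * (u - 1/2) * dickman (u - 1/2)"
      using dickman_shift_half[of "u - 1/2"] by simp
    also have "\<dots> \<le> 2 * u * dickman (u - 1/2)"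
      using dickman_pos[of "u - 1/2"] False by (intro mult_right_mono) auto
    finally show ?thesis .
  qed
  also have "\<dots> \<le> 2 * u * (2 * u * dickman u)"
    using dickman_shift_half[OF assms] assms by (intro mult_left_mono) auto
  finally show ?thesis by (simp add: power2_eq_square)
qed

text \<open>The previous lemma bounds the logarithmic derivative below by \<open>- 4 * x\<close>, so
  \<open>dickman x * exp (2 * x\<^sup>2)\<close> increases.\<close>

lemma dickman_le_exp:
  assumes "1 \<le> v" "v \<le> u"
  shows "dickman v \<le> dickman u * exp (2 * (u\<^sup>2 - v\<^sup>2))"
proof -
  define h where "h x = dickman x * exp (2 * x\<^sup>2)" for x
  have "h v \<le> h u"
  proof (rule DERIV_nonneg_imp_increasing_open[OF assms(2)])
    show "continuous_on {v..u} h"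
      unfolding h_def using assms by (intro continuous_intros continuous_dickman) auto
    fix x assume x: "v < x" "x < u"
    have x1: "x > 1" using x assms by simp
    have "(h has_real_derivative
        (- dickman (x - 1) / x) * exp (2 * x\<^sup>2) + dickman x * (exp (2 * x\<^sup>2) * (4 * x))) (at x)"
      unfolding h_def[abs_def] using x1
      by (auto intro!: derivative_eq_intros dickman_has_derivative)
    moreover have "dickman (x - 1) / x \<le> 4 * x * dickman x"
      using dickman_shift_one[of x] x1 by (simp add: field_simps power2_eq_square)
    then have "0 \<le> (- dickman (x - 1) / x + 4 * x * dickman x) * exp (2 * x\<^sup>2)" by simp
    ultimately show "\<exists>y. (h has_real_derivative y) (at x) \<and> 0 \<le> y"
      by (auto simp: algebra_simps)
  qed
  then show ?thesis by (simp add: h_def exp_diff right_diff_distrib field_simps)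
qed

text \<open>
  Stretching the unit from \<open>r\<close> to \<open>r + 1\<close> absorbs the error of the Riemann sum completely.
\<close>

lemma dickman_supersolution:
  assumes "r + 1 \<le> m"
  shows "(\<Sum>i=m-r..<m. dickman (real i / real (r + 1))) \<le> real m * dickman (real m / real (r + 1))"
proof -
  define s where "s = real (r + 1)"
  define G where "G x = integral {0..x} dickman" for x
  have s: "s > 0" by (simp add: s_def)
  have "dickman (real i / s) \<le> s * (G (real i / s) - G (real (i - 1) / s))" if "i \<in> {m-r..<m}" for i
  proof -
    \<comment> \<open>\<open>r + 1 \<le> m\<close> gives \<open>i \<ge> 1\<close>, so the
      predecessor is not truncated. Each term is compared with the integral over the cell to its
      left, where the decreasing integrand is larger.\<close>
    have "real (i - 1) = real i - 1" using that assms by auto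
    then have *: "real i / s - real (i - 1) / s = 1 / s" by (simp add: diff_divide_distrib[symmetric])
    have "1 / s * dickman (real i / s) \<le> G (real i / s) - G (real (i - 1) / s)"
      unfolding G_def *[symmetric] using s
      by (subst integral_dickman_diff) (auto intro!: integral_dickman_bounds divide_right_mono)
    then show ?thesis using s by (simp add: field_simps)
  qed
  then have "(\<Sum>i=m-r..<m. dickman (real i / s)) \<le>
      (\<Sum>i=m-r..<m. s * (G (real i / s) - G (real (i - 1) / s)))"
    by (rule sum_mono)
  also have "\<dots> = s * (\<Sum>i=m-r..<m. G (real i / s) - G (real (i - 1) / s))"
    by (simp add: sum_distrib_left)
  also have "(\<Sum>i=m-r..<m. G (real i / s) - G (real (i - 1) / s)) =
      (\<Sum>i=m-r-1..<m-1. G (real (Suc i) / s) - G (real i / s))"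
    by (rule sum.reindex_bij_witness[of _ Suc "\<lambda>i. i - 1"]) (use assms in auto)
  also have "\<dots> = G (real (m - 1) / s) - G (real (m - r - 1) / s)"
    by (rule sum_Suc_diff') auto
  also have "\<dots> \<le> G (real m / s) - G (real m / s - 1)"
  proof -
    \<comment> \<open>The cells run from \<open>m - r - 1\<close> to \<open>m - 1\<close>. Because
      \<open>s = r + 1\<close>, their left end is exactly one unit before \<open>m / s\<close>;
      adding the last cell only increases the integral.\<close>
    have "real (m - r - 1) / s = real m / s - 1"
      using assms by (simp add: s_def field_simps of_nat_diff)
    moreover have "0 \<le> integral {real (m - 1) / s..real m / s} dickman"
      using s by (intro integral_nonneg dickman_integrable)
        (auto intro!: less_imp_le[OF dickman_pos] elim!: order_trans[rotated])
    then have "G (real (m - 1) / s) \<le> G (real m / s)"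
      using integral_dickman_diff[of "real (m - 1) / s" "real m / s"] s
      by (simp add: G_def divide_right_mono)
    ultimately show ?thesis by simp
  qed
  also have "\<dots> = real m / s * dickman (real m / s)"
    using dickman_integral_eq[of "real m / s"] integral_dickman_diff[of "real m / s - 1" "real m / s"]
      assms s by (simp add: G_def s_def field_simps)
  finally show ?thesis using s by (simp add: s_def)
qed

subsection \<open>The range of bounded \<open>(n/r)\<^sup>2/r\<close>\<close>

text \<open>With at most \<open>2 * r + 1\<close> points there is room for one long cycle only; in
  the recurrence just the term at 0 is nonzero.\<close>

lemma kappa_eq_inverse:
  assumes "r < m" "m \<le> 2 * r + 1"
  shows "kappa m r = 1 / real m"
proof -
  have zero: "kappa i r = 0" if "1 \<le> i" "i \<le> r" for i
    using kappa_rec[of i r] that by simp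
  have "(\<Sum>i<m - r. kappa i r) = (\<Sum>i\<in>{0}. kappa i r)"
  proof (rule sum.mono_neutral_right)
    show "\<forall>i\<in>{..<m - r} - {0}. kappa i r = 0" using assms by (auto intro!: zero)
  qed (use assms in auto)
  then show ?thesis using kappa_rec[of m r] assms by (simp add: field_simps)
qed

text \<open>Strong induction. For \<open>i \<le> 2 * r\<close> the differences are explicit, and the
  constant is fitted to \<open>Suc i / (r + 1) \<le> 2\<close>; beyond that,
  \<open>kappa_diff\<close> is played against \<open>dickman_supersolution\<close>.\<close>

lemma kappa_diff_le_dickman:
  assumes r: "r \<ge> 1" and i: "r < i"
  shows "\<bar>kappa (Suc i) r - kappa i r\<bar> \<le>
         1 / (dickman 2 * real r ^ 2) * dickman (real (Suc i) / real (r + 1))"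
  using i
proof (induction i rule: less_induct)
  case (less i)
  define K where "K = 1 / (dickman 2 * real r ^ 2)"
  have K: "K \<ge> 0" by (simp add: K_def less_imp_le[OF dickman_pos])
  show ?case
  proof (cases "i \<le> 2 * r")
    case True
    have "kappa (Suc i) r - kappa i r = 1 / real (Suc i) - 1 / real i"
      using kappa_eq_inverse[of r i] kappa_eq_inverse[of r "Suc i"] True less(2) by simp
    also have "\<dots> = - (1 / (real i * real (Suc i)))" using less(2) by (simp add: field_simps)
    finally have "\<bar>kappa (Suc i) r - kappa i r\<bar> = 1 / (real i * real (Suc i))" by simp
    also have "\<dots> \<le> 1 / (real r * real r)"
      using less(2) r by (intro divide_left_mono mult_mono) auto
    also have "\<dots> = K * dickman 2"
      using dickman_pos[of 2] by (simp add: K_def power2_eq_square)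
    also have "\<dots> \<le> K * dickman (real (Suc i) / real (r + 1))"
      using True K by (intro mult_left_mono dickman_antimono) (auto simp: field_simps)
    finally show ?thesis by (simp add: K_def)
  next
    case False
    \<comment> \<open>Since \<open>i > 2 * r\<close>, all indices of the window exceed
      \<open>r\<close>, so the induction hypothesis covers them.\<close>
    have "real (Suc i) * \<bar>kappa (Suc i) r - kappa i r\<bar> =
        \<bar>\<Sum>k=i-r..<i. kappa (Suc k) r - kappa k r\<bar>"
      using less(2) by (subst abs_minus_cancel[symmetric], subst kappa_diff[symmetric])
        (simp_all add: abs_mult)
    also have "\<dots> \<le> (\<Sum>k=i-r..<i. \<bar>kappa (Suc k) r - kappa k r\<bar>)" by (rule sum_abs)
    also have "\<dots> \<le> (\<Sum>k=i-r..<i. K * dickman (real (Suc k) / real (r + 1)))"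
      unfolding K_def by (intro sum_mono less.IH) (use False in auto)
    also have "\<dots> = K * (\<Sum>k=Suc i-r..<Suc i. dickman (real k / real (r + 1)))"
      unfolding sum_distrib_left
      by (rule sum.reindex_bij_witness[of _ "\<lambda>i. i - 1" Suc]) (use less(2) in auto)
    also have "\<dots> \<le> K * (real (Suc i) * dickman (real (Suc i) / real (r + 1)))"
      using less(2) K by (intro mult_left_mono dickman_supersolution) auto
    finally have "real (Suc i) * \<bar>kappa (Suc i) r - kappa i r\<bar> \<le>
        real (Suc i) * (K * dickman (real (Suc i) / real (r + 1)))" by (simp add: mult_ac)
    then have "\<bar>kappa (Suc i) r - kappa i r\<bar> \<le> K * dickman (real (Suc i) / real (r + 1))"
      by (rule mult_left_le_imp_le) simp
    then show ?thesis by (simp add: K_def)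
  qed
qed

text \<open>Blocks of length \<open>s\<close>: the first contributes at most \<open>s\<close> times
  its initial value, and \<open>dickman_le_half\<close> halves the value from one block to the
  next.\<close>

lemma sum_dickman_tail:
  assumes s: "s \<ge> 1" and n: "s \<le> n"
  shows "(\<Sum>i=n..<N. dickman (real (Suc i) / real s)) \<le> 2 * real s * dickman (real n / real s)"
  using n
proof (induction "N - n" arbitrary: n rule: less_induct)
  case less
  have le: "dickman (real (Suc i) / real s) \<le> dickman (real n / real s)" if "n \<le> i" for i
    using that by (intro dickman_antimono divide_right_mono) auto
  have pos: "0 < dickman (real n / real s)" by (intro dickman_pos) auto
  show ?case
  proof (cases "N \<le> n + s")
    case True
    have "(\<Sum>i=n..<N. dickman (real (Suc i) / real s)) \<le> (\<Sum>i=n..<N. dickman (real n / real s))"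
      by (intro sum_mono le) auto
    also have "\<dots> = real (N - n) * dickman (real n / real s)" by simp
    also have "\<dots> \<le> 2 * real s * dickman (real n / real s)"
      using True pos by (intro mult_right_mono) auto
    finally show ?thesis .
  next
    case False
    have "(\<Sum>i=n..<N. dickman (real (Suc i) / real s)) =
        (\<Sum>i=n..<n + s. dickman (real (Suc i) / real s)) +
        (\<Sum>i=n + s..<N. dickman (real (Suc i) / real s))"
      by (rule sum.atLeastLessThan_concat[symmetric]) (use False in auto)
    also have "(\<Sum>i=n..<n + s. dickman (real (Suc i) / real s)) \<le>
        (\<Sum>i=n..<n + s. dickman (real n / real s))"
      by (intro sum_mono le) auto
    also have "(\<Sum>i=n + s..<N. dickman (real (Suc i) / real s)) \<le>
        2 * real s * dickman (real (n + s) / real s)"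
      by (rule less.hyps) (use False s less(2) in auto)
    also have "real (n + s) / real s = real n / real s + 1" using s by (simp add: field_simps)
    also have "dickman (real n / real s + 1) \<le> dickman (real n / real s) / 2"
      using less(2) s by (intro dickman_le_half) simp
    finally show ?thesis using s by simp
  qed
qed

lemma kappa_limit_le_dickman:
  assumes r: "r \<ge> 1" and n: "r < n"
  shows "\<bar>kappa n r - exp (- harm r)\<bar> \<le> 4 / dickman 2 * (dickman (real n / real (r + 1)) / real r)"
proof (rule kappa_minus_limit_le)
  fix N
  define K where "K = 1 / (dickman 2 * real r ^ 2)"
  have K: "K \<ge> 0" by (simp add: K_def less_imp_le[OF dickman_pos])
  have "(\<Sum>i=n..<N. \<bar>kappa (Suc i) r - kappa i r\<bar>) \<le>
      (\<Sum>i=n..<N. K * dickman (real (Suc i) / real (r + 1)))"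
    unfolding K_def using n by (intro sum_mono kappa_diff_le_dickman r) auto
  also have "\<dots> = K * (\<Sum>i=n..<N. dickman (real (Suc i) / real (r + 1)))"
    by (simp add: sum_distrib_left)
  also have "\<dots> \<le> K * (2 * real (r + 1) * dickman (real n / real (r + 1)))"
    using n by (intro mult_left_mono sum_dickman_tail K) auto
  also have "\<dots> \<le> K * (4 * real r * dickman (real n / real (r + 1)))"
    using r K dickman_pos[of "real n / real (r + 1)"] by (intro mult_left_mono mult_right_mono) auto
  also have "\<dots> = 4 / dickman 2 * (dickman (real n / real (r + 1)) / real r)"
    using r by (simp add: K_def power2_eq_square)
  finally show "(\<Sum>i=n..<N. \<bar>kappa (Suc i) r - kappa i r\<bar>) \<le>
      4 / dickman 2 * (dickman (real n / real (r + 1)) / real r)" .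
qed

text \<open>With \<open>u = n / r\<close> and \<open>v = n / (r + 1)\<close>,
  \<open>u\<^sup>2 - v\<^sup>2\<close> is at most \<open>2 * u\<^sup>2 / r \<le> 2 * K\<close>, so
  \<open>dickman_le_exp\<close> replaces \<open>v\<close> by \<open>u\<close> at bounded
  cost.\<close>

lemma kappa_limit_le_few:
  assumes r: "r \<ge> 1" and n: "r < n" and K: "(real n / real r)\<^sup>2 \<le> K * real r"
  shows "\<bar>kappa n r - exp (- harm r)\<bar> \<le>
         4 / dickman 2 * exp (4 * K) * (dickman (real n / real r) / real r)"
proof -
  define u where "u = real n / real r"
  define v where "v = real n / real (r + 1)"
  have v: "1 \<le> v" "v \<le> u" using n r by (auto simp: v_def u_def field_simps)
  have "u - v = u / real (r + 1)"
    using r by (simp add: u_def v_def field_simps)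
  then have "u\<^sup>2 - v\<^sup>2 = (u + v) * u / real (r + 1)"
    by (simp add: square_diff_square_factored power2_eq_square)
  also have "\<dots> \<le> 2 * u\<^sup>2 / real r"
    using v r by (intro frac_le) (auto simp: power2_eq_square intro!: mult_right_mono)
  also have "\<dots> \<le> 2 * K" using K r by (simp add: u_def divide_le_eq)
  finally have "2 * (u\<^sup>2 - v\<^sup>2) \<le> 4 * K" by simp
  then have "dickman v \<le> dickman u * exp (4 * K)"
    using dickman_le_exp[OF v] dickman_pos[of u] v
    by (smt (verit) exp_le_cancel_iff mult_left_mono)
  then have "4 / dickman 2 * (dickman v / real r) \<le>
      4 / dickman 2 * (dickman u * exp (4 * K) / real r)"
    using dickman_pos[of 2] by (intro mult_left_mono divide_right_mono) auto
  then show ?thesis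
    using kappa_limit_le_dickman[OF r n] by (simp add: u_def v_def mult_ac)
qed

subsection \<open>A lower bound for Dickman's function\<close>

text \<open>The mean of \<open>exp (t * x)\<close> over \<open>t\<close> in \<open>{0..1}\<close>,
  with the singularity at 0 removed.\<close>

definition exp_mean :: "real \<Rightarrow> real" where
  "exp_mean x = (if x = 0 then 1 else (exp x - 1) / x)"

lemma continuous_exp_mean: "continuous_on A exp_mean"
proof -
  have "isCont exp_mean x" for x
  proof (cases "x = 0")
    case True
    have "exp_mean \<midarrow>0\<rightarrow> 1"
      by (rule Lim_transform_eventually[OF lim_exp_minus_1])
         (auto simp: exp_mean_def eventually_at_filter)
    then show ?thesis by (simp add: True isCont_def exp_mean_def)
  next
    case False
    have "isCont (\<lambda>x. (exp x - 1) / x) x" using False by (intro continuous_intros)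
    moreover have "\<forall>\<^sub>F y in nhds x. exp_mean y = (exp y - 1) / y"
      using t1_space_nhds[OF False] by eventually_elim (simp add: exp_mean_def)
    ultimately show ?thesis by (simp add: isCont_cong)
  qed
  then show ?thesis by (simp add: continuous_at_imp_continuous_on)
qed

lemma exp_mean_strict_mono:
  assumes "0 \<le> a" "a < b"
  shows "exp_mean a < exp_mean b"
proof (rule DERIV_pos_imp_increasing_open[OF assms(2)])
  fix x assume "a < x" "x < b"
  then have x: "x > 0" using assms by simp
  have "((\<lambda>x. (exp x - 1) / x) has_real_derivative (exp x * x - (exp x - 1)) / x\<^sup>2) (at x)"
    using x by (auto intro!: derivative_eq_intros simp: power2_eq_square)
  then have "(exp_mean has_real_derivative (exp x * x - (exp x - 1)) / x\<^sup>2) (at x)"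
    by (rule has_field_derivative_transform_within_open[where S = "{0<..}"])
       (use x in \<open>auto simp: exp_mean_def\<close>)
  moreover have "exp x * (1 - x) < exp x * exp (- x)"
    using x exp_minus_greater[of x] by (intro mult_strict_left_mono) auto
  then have "exp x * x - (exp x - 1) > 0"
    by (simp add: exp_minus algebra_simps)
  ultimately show "\<exists>y. (exp_mean has_real_derivative y) (at x) \<and> 0 < y"
    using x by (intro exI[of _ "(exp x * x - (exp x - 1)) / x\<^sup>2"] conjI) auto
qed (rule continuous_exp_mean)

lemma exp_mean_mono: "0 \<le> a \<Longrightarrow> a \<le> b \<Longrightarrow> exp_mean a \<le> exp_mean b"
  using exp_mean_strict_mono[of a b] by (cases "a = b") auto

lemma exp_mean_ge: "0 \<le> x \<Longrightarrow> 1 + x / 2 \<le> exp_mean x"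
  using exp_lower_Taylor_quadratic[of x] by (auto simp: exp_mean_def field_simps power2_eq_square)

lemma integral_exp_eq_exp_mean: "integral {u - 1..u} (\<lambda>x. exp ((u - x) * y)) = exp_mean y"
proof (cases "y = 0")
  case False
  have "((\<lambda>x. exp ((u - x) * y)) has_integral
      (- exp ((u - u) * y) / y - (- exp ((u - (u - 1)) * y) / y))) {u - 1..u}"
  proof (rule fundamental_theorem_of_calculus)
    fix x
    have "((\<lambda>x. - exp ((u - x) * y) / y) has_real_derivative exp ((u - x) * y)) (at x within {u - 1..u})"
      using False by (auto intro!: derivative_eq_intros)
    then show "((\<lambda>x. - exp ((u - x) * y) / y) has_vector_derivative exp ((u - x) * y))
        (at x within {u - 1..u})"
      by (simp add: has_real_derivative_iff_has_vector_derivative)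
  qed auto
  then have "integral {u - 1..u} (\<lambda>x. exp ((u - x) * y)) =
      - exp ((u - u) * y) / y - (- exp ((u - (u - 1)) * y) / y)" by (rule integral_unique)
  then show ?thesis using False by (simp add: exp_mean_def diff_divide_distrib)
qed (simp add: exp_mean_def)

text \<open>For \<open>x > 0\<close> this is \<open>Ei x - ln x - \<gamma>\<close>, the exponent in
  the saddle-point estimate of Dickman's function.\<close>

definition exp_mean_int :: "real \<Rightarrow> real" where
  "exp_mean_int x = integral {0..x} exp_mean"

text \<open>The tangent inequality of a function with increasing derivative; \<open>b\<close> may
  lie on either side of \<open>a\<close>.\<close>

lemma exp_mean_int_convex:
  assumes "0 \<le> a" "0 \<le> b"
  shows "exp_mean a * (b - a) \<le> exp_mean_int b - exp_mean_int a"
proof -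
  have int: "exp_mean integrable_on {a..b}" for a b
    by (intro integrable_continuous_real continuous_exp_mean)
  have diff: "exp_mean_int b - exp_mean_int a = integral {a..b} exp_mean"
    if "0 \<le> a" "a \<le> b" for a b
    unfolding exp_mean_int_def
    using Henstock_Kurzweil_Integration.integral_combine[OF that int] by simp
  show ?thesis
  proof (cases "a \<le> b")
    case True
    have "integral {a..b} (\<lambda>_. exp_mean a) \<le> integral {a..b} exp_mean"
      using assms by (intro integral_le int) (auto intro: exp_mean_mono)
    then show ?thesis using diff[of a b] True assms by (simp add: mult.commute)
  next
    case False
    have "integral {b..a} exp_mean \<le> integral {b..a} (\<lambda>_. exp_mean a)"
      using assms by (intro integral_le int) (auto intro: exp_mean_mono)
    then show ?thesis using diff[of b a] False assms by (simp add: algebra_simps)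
  qed
qed

lemma exp_mean_int_0 [simp]: "exp_mean_int 0 = 0"
  by (simp add: exp_mean_int_def)

lemma exp_mean_int_nonneg: "0 \<le> x \<Longrightarrow> 0 \<le> exp_mean_int x"
  using exp_mean_int_convex[of 0 x] by (simp add: exp_mean_def)

text \<open>Each term is \<open>exp_mean\<close> at a grid point times the mesh
  \<open>x / r\<close>, so the terms \<open>j < r\<close> form a left-endpoint sum of an increasing
  function. The term \<open>j = r\<close> has no cell left in \<open>{0..x}\<close> and yields
  \<open>exp x / r\<close>.\<close>

lemma sum_exp_le_exp_mean_int:
  assumes r: "r \<ge> 1" and x: "0 \<le> x"
  shows "(\<Sum>j=1..r. (exp (x * real j / real r) - 1) / real j) \<le> exp_mean_int x + exp x / real r"
proof -
  define f where "f j = exp_mean_int (x * real j / real r)" for j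
  have "(exp (x * real j / real r) - 1) / real j \<le> f (Suc j) - f j" if "j \<in> {1..<r}" for j
  proof -
    have "(exp (x * real j / real r) - 1) / real j = exp_mean (x * real j / real r) * (x / real r)"
      using that r by (simp add: exp_mean_def)
    also have "x / real r = x * real (Suc j) / real r - x * real j / real r"
      by (simp add: diff_divide_distrib[symmetric] algebra_simps)
    also have "exp_mean (x * real j / real r) * \<dots> \<le> f (Suc j) - f j"
      unfolding f_def using x by (intro exp_mean_int_convex) auto
    finally show ?thesis .
  qed
  then have "(\<Sum>j=1..<r. (exp (x * real j / real r) - 1) / real j) \<le> (\<Sum>j=1..<r. f (Suc j) - f j)"
    by (rule sum_mono)
  also have "\<dots> = f r - f 1" using r by (rule sum_Suc_diff')
  also have "\<dots> \<le> exp_mean_int x" using r x by (simp add: f_def exp_mean_int_nonneg)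
  finally have "(\<Sum>j=1..<r. (exp (x * real j / real r) - 1) / real j) \<le> exp_mean_int x" .
  moreover have "{1..r} = insert r {1..<r}" using r by auto
  moreover have "(exp x - 1) / real r \<le> exp x / real r" by (simp add: divide_right_mono)
  ultimately show ?thesis using r by simp
qed

section \<open>The inverse function and the Legendre transform\<close>

definition exp_mean_inv :: "real \<Rightarrow> real" where
  "exp_mean_inv s = (SOME x. 0 \<le> x \<and> exp_mean x = s)"

lemma exp_mean_inv:
  assumes "1 \<le> s"
  shows "0 \<le> exp_mean_inv s" "exp_mean (exp_mean_inv s) = s"
proof -
  have "\<exists>x. 0 \<le> x \<and> x \<le> 2 * s \<and> exp_mean x = s"
    using assms exp_mean_ge[of "2 * s"] continuous_exp_mean
    by (intro IVT') (auto simp: exp_mean_def)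
  then have "0 \<le> exp_mean_inv s \<and> exp_mean (exp_mean_inv s) = s"
    unfolding exp_mean_inv_def by (metis (mono_tags, lifting) someI_ex)
  then show "0 \<le> exp_mean_inv s" "exp_mean (exp_mean_inv s) = s" by auto
qed

lemma exp_mean_inv_mono: "1 \<le> s \<Longrightarrow> s \<le> t \<Longrightarrow> exp_mean_inv s \<le> exp_mean_inv t"
  using exp_mean_inv[of s] exp_mean_inv[of t] exp_mean_strict_mono[of "exp_mean_inv t" "exp_mean_inv s"]
  by fastforce

text \<open>The Legendre transform of \<^const>\<open>exp_mean_int\<close>.\<close>

definition exp_mean_conj :: "real \<Rightarrow> real" where
  "exp_mean_conj s = s * exp_mean_inv s - exp_mean_int (exp_mean_inv s)"

lemma exp_mean_conj_ge:
  assumes "1 \<le> s" "0 \<le> x"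
  shows "s * x - exp_mean_int x \<le> exp_mean_conj s"
  using exp_mean_int_convex[of "exp_mean_inv s" x] exp_mean_inv[of s] assms
  by (simp add: exp_mean_conj_def algebra_simps)

text \<open>The maximiser for \<open>s\<close> is a competitor in the supremum for \<open>t\<close>,
  so \<open>exp_mean_inv s\<close> is a subgradient at \<open>s\<close>.\<close>

lemma exp_mean_conj_convex:
  assumes "1 \<le> s" "1 \<le> t"
  shows "exp_mean_inv s * (t - s) \<le> exp_mean_conj t - exp_mean_conj s"
  using exp_mean_conj_ge[of t "exp_mean_inv s"] exp_mean_inv[of s] assms
  by (simp add: exp_mean_conj_def algebra_simps)

text \<open>On \<open>{1..b}\<close> the subgradients lie between 0 and
  \<open>exp_mean_inv b\<close>, which gives a Lipschitz bound.\<close>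

lemma continuous_exp_mean_conj: "continuous_on {1..} exp_mean_conj"
proof -
  have "continuous_on {1..b} exp_mean_conj" for b
  proof (rule lipschitz_on_continuous_on, rule lipschitz_onI)
    fix s t assume st: "s \<in> {1..b}" "t \<in> {1..b}"
    have "\<bar>exp_mean_conj t - exp_mean_conj s\<bar> \<le> \<bar>exp_mean_inv b\<bar> * \<bar>t - s\<bar>"
      if "1 \<le> s" "s \<le> t" "t \<le> b" for s t
    proof -
      have "0 \<le> exp_mean_inv s * (t - s)" using exp_mean_inv[of s] that by simp
      moreover have "exp_mean_inv t * (t - s) \<le> \<bar>exp_mean_inv b\<bar> * (t - s)"
        using exp_mean_inv_mono[of t b] that by (intro mult_right_mono) auto
      ultimately show ?thesis
        using exp_mean_conj_convex[of s t] exp_mean_conj_convex[of t s] that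
        by (simp add: algebra_simps)
    qed
    from this[of s t] this[of t s] st
    show "dist (exp_mean_conj s) (exp_mean_conj t) \<le> \<bar>exp_mean_inv b\<bar> * dist s t"
      by (cases "s \<le> t") (auto simp: dist_real_def abs_minus_commute)
  qed auto
  then have "continuous (at x within {1..x + 1}) exp_mean_conj" if "x \<ge> 1" for x
    using that unfolding continuous_on_eq_continuous_within by auto
  moreover have "at x within {1..x + 1} = at x within {1..}" for x :: real
    by (rule at_within_nhd[of x "{..<x + 1}"]) auto
  ultimately show ?thesis unfolding continuous_on_eq_continuous_within by simp
qed

text \<open>
  The shift by one in \<open>exp_mean_conj (v + 1)\<close> is what makes \<open>g\<close> a subsolution: on the whole unit
  interval before \<open>v\<close> its logarithmic slope is then at least \<open>exp_mean_inv v\<close>. It costs only the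
  factor \<open>exp x\<close>.
\<close>

lemma dickman_lower_bound:
  assumes "0 \<le> u" "0 \<le> x" "exp_mean x = u + 1"
  shows "exp (exp_mean_int x - x * (u + 1)) / 2 \<le> dickman u"
proof -
  \<comment> \<open>The transform is nonnegative, as its supremum includes the point 0; halving
    therefore makes the initial comparison with 1 strict.\<close>
  define g where "g v = exp (- exp_mean_conj (v + 1)) / 2" for v
  have cont: "continuous_on {0..} g"
    unfolding g_def
    by (intro continuous_intros continuous_on_compose2[OF continuous_exp_mean_conj]) auto
  have "g u < dickman u"
  proof (rule dickman_gt_subsolution[OF cont])
    fix v :: real assume v: "0 \<le> v"
    have "exp (- exp_mean_conj (v + 1)) \<le> 1" using exp_mean_conj_ge[of "v + 1" 0] v by simp
    then show "g v < 1" unfolding g_def by linarith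
  next
    fix v :: real assume v: "1 \<le> v"
    let ?y = "exp_mean_inv v"
    \<comment> \<open>\<open>v = exp_mean ?y\<close> turns the factor \<open>v\<close> into the
      integral of an exponential with slope \<open>?y\<close>.\<close>
    have "v * g v = integral {v - 1..v} (\<lambda>x. g v * exp ((v - x) * ?y))"
      using exp_mean_inv[OF v] by (simp add: integral_exp_eq_exp_mean)
    also have "\<dots> \<le> integral {v - 1..v} g"
    proof (rule integral_le)
      show "g integrable_on {v - 1..v}"
        using v by (intro integrable_continuous_real continuous_on_subset[OF cont]) auto
      fix x assume x: "x \<in> {v - 1..v}"
      have "(v - x) * ?y \<le> (v - x) * exp_mean_inv (x + 1)"
        using x v by (intro mult_left_mono exp_mean_inv_mono) auto
      also have "\<dots> \<le> exp_mean_conj (v + 1) - exp_mean_conj (x + 1)"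
        using exp_mean_conj_convex[of "x + 1" "v + 1"] x v by (simp add: mult.commute)
      finally show "g v * exp ((v - x) * ?y) \<le> g x"
        by (simp add: g_def exp_add[symmetric])
    qed (intro integrable_continuous_real continuous_intros)
    finally show "v * g v \<le> integral {v - 1..v} g" .
  qed (use assms in auto)
  moreover have "exp_mean_inv (u + 1) = x"
    using exp_mean_inv[of "u + 1"] exp_mean_strict_mono[of x "exp_mean_inv (u + 1)"]
      exp_mean_strict_mono[of "exp_mean_inv (u + 1)" x] assms by fastforce
  ultimately show ?thesis by (simp add: g_def exp_mean_conj_def algebra_simps)
qed

subsection \<open>The range of large \<open>(n/r)\<^sup>2/r\<close>\<close>

lemma sin_ge_half:
  fixes y :: real
  assumes "0 \<le> y" "y \<le> pi / 2"
  shows "y / 2 \<le> sin y"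
proof -
  have *: "z * cos z \<le> sin z" if z: "0 \<le> z" "z \<le> pi" for z :: real
  proof -
    have "sin 0 - 0 * cos 0 \<le> sin z - z * cos z"
    proof (rule DERIV_nonneg_imp_nondecreasing[OF z(1)])
      fix x assume x: "0 \<le> x" "x \<le> z"
      have "((\<lambda>x. sin x - x * cos x) has_real_derivative x * sin x) (at x)"
        by (auto intro!: derivative_eq_intros)
      moreover have "0 \<le> x * sin x" using x z by (intro mult_nonneg_nonneg sin_ge_zero) auto
      ultimately show "\<exists>y. ((\<lambda>x. sin x - x * cos x) has_real_derivative y) (at x) \<and> 0 \<le> y" by blast
    qed
    then show ?thesis by simp
  qed
  \<comment> \<open>Half angles: \<open>sin y = 2 * sin (y/2) * cos (y/2)\<close>, and
    \<open>z * cos z \<le> sin z\<close> at \<open>z = y/2\<close> bounds this below by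
    \<open>y * (1 + cos y) / 2\<close>.\<close>
  have "y / 2 \<le> y / 2 * (1 + cos y)"
    using assms cos_ge_zero[of y] by (simp add: mult_le_cancel_left1)
  also have "1 + cos y = 2 * (cos (y / 2))\<^sup>2" using cos_double_cos[of "y / 2"] by simp
  also have "y / 2 * (2 * (cos (y / 2))\<^sup>2) = 2 * (y / 2 * cos (y / 2)) * cos (y / 2)"
    by (simp add: power2_eq_square)
  also have "\<dots> \<le> 2 * sin (y / 2) * cos (y / 2)"
    using assms *[of "y / 2"] cos_ge_zero[of "y / 2"] by (intro mult_right_mono mult_left_mono) auto
  also have "\<dots> = sin y" using sin_double[of "y / 2"] by simp
  finally show ?thesis .
qed

text \<open>As \<open>1 + cos s = 2 * (cos (s/2))\<^sup>2\<close>, this is \<open>\<bar>sin (b -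
  a)\<bar> \<le> \<bar>cos a\<bar> + \<bar>cos b\<bar>\<close> at the half angles.\<close>

lemma one_plus_cos_pair:
  fixes t s :: real
  shows "(sin ((t - s) / 2))\<^sup>2 \<le> (1 + cos s) + (1 + cos t)"
proof -
  define a b where "a = s / 2" and "b = t / 2"
  have "(sin (b - a))\<^sup>2 \<le> (\<bar>cos a\<bar> + \<bar>cos b\<bar>)\<^sup>2"
  proof -
    have "\<bar>sin (b - a)\<bar> \<le> \<bar>sin b * cos a\<bar> + \<bar>cos b * sin a\<bar>"
      unfolding sin_diff by (rule abs_triangle_ineq4)
    also have "\<dots> \<le> \<bar>cos a\<bar> + \<bar>cos b\<bar>"
      by (simp add: abs_mult add_mono mult_left_le mult_left_le_one_le)
    finally show ?thesis by (metis abs_le_square_iff abs_of_nonneg abs_ge_zero add_nonneg_nonneg)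
  qed
  also have "\<dots> \<le> 2 * (cos a)\<^sup>2 + 2 * (cos b)\<^sup>2"
    using sum_squares_bound[of "\<bar>cos a\<bar>" "\<bar>cos b\<bar>"] by (simp add: power2_sum)
  also have "\<dots> = (1 + cos s) + (1 + cos t)"
    using cos_double_cos[of a] cos_double_cos[of b] by (simp add: a_def b_def)
  finally show ?thesis by (simp add: a_def b_def diff_divide_distrib)
qed

text \<open>
  Two angles that differ by \<open>h \<theta>\<close> cannot both be near \<open>\<pi>\<close>, so the terms are paired at distance \<open>h\<close>.
\<close>

lemma sum_one_plus_cos_ge:
  fixes \<theta> :: real
  assumes "h \<le> M" "2 * M \<le> r"
  shows "real M / 2 * (sin (real h * \<theta> / 2))\<^sup>2 \<le> (\<Sum>j\<in>{r - 2 * M<..r}. 1 + cos (real j * \<theta>))"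
proof -
  define c where "c j = 1 + cos (real j * \<theta>)" for j
  have c: "0 \<le> c j" for j using cos_ge_minus_one[of "real j * \<theta>"] unfolding c_def by linarith
  \<comment> \<open>The lower half of the window: \<open>h \<le> M\<close> keeps
    \<open>j + h\<close> inside it. Every term is then used at most twice, hence the factor 1/2 in
    the claim.\<close>
  define J where "J = {r - 2 * M<..r - M}"
  have "(\<Sum>j\<in>J. (sin (real h * \<theta> / 2))\<^sup>2) \<le> (\<Sum>j\<in>J. c j + c (j + h))"
  proof (rule sum_mono)
    fix j
    show "(sin (real h * \<theta> / 2))\<^sup>2 \<le> c j + c (j + h)"
      using one_plus_cos_pair[of "real (j + h) * \<theta>" "real j * \<theta>"]
      by (simp add: c_def algebra_simps)
  qed
  also have "\<dots> = (\<Sum>j\<in>J. c j) + (\<Sum>j\<in>J. c (j + h))" by (rule sum.distrib)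
  also have "(\<Sum>j\<in>J. c (j + h)) = (\<Sum>j\<in>(\<lambda>j. j + h) ` J. c j)"
    by (subst sum.reindex) (auto simp: inj_on_def)
  also have "\<dots> \<le> (\<Sum>j\<in>{r - 2 * M<..r}. c j)"
    by (rule sum_mono2) (use assms c in \<open>auto simp: J_def\<close>)
  also have "(\<Sum>j\<in>J. c j) \<le> (\<Sum>j\<in>{r - 2 * M<..r}. c j)"
    by (rule sum_mono2) (use assms c in \<open>auto simp: J_def\<close>)
  also have "card J = M" using assms by (simp add: J_def)
  then have "(\<Sum>j\<in>J. (sin (real h * \<theta> / 2))\<^sup>2) = real M * (sin (real h * \<theta> / 2))\<^sup>2" by simp
  finally show ?thesis by (simp add: c_def)
qed

lemma nat_floor_ge_half:
  fixes y :: real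
  assumes "1 \<le> y"
  shows "y / 2 \<le> real (nat \<lfloor>y\<rfloor>)" "real (nat \<lfloor>y\<rfloor>) \<le> y"
proof -
  have "1 \<le> \<lfloor>y\<rfloor>" using assms by (simp add: le_floor_iff)
  then have "1 \<le> real_of_int \<lfloor>y\<rfloor>" "real (nat \<lfloor>y\<rfloor>) = real_of_int \<lfloor>y\<rfloor>" by auto
  then show "y / 2 \<le> real (nat \<lfloor>y\<rfloor>)" "real (nat \<lfloor>y\<rfloor>) \<le> y"
    using floor_correct[of y] by linarith+
qed

text \<open>If \<open>r * \<theta> \<le> 1\<close>, all cosines are nonnegative. Otherwise a step
  \<open>h\<close> is found with \<open>h * \<theta> / 2\<close> between \<open>1 / (8 * x)\<close>
  and \<open>pi / 2\<close>; its sine is at least \<open>1 / (16 * x)\<close>, and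
  \<open>2048 = 4 * 2 * 16^2\<close>.\<close>

lemma sum_top_one_plus_cos_ge:
  fixes x \<theta> :: real and M r :: nat
  assumes x: "1 \<le> x" "2 * x \<le> real r" and \<theta>: "0 \<le> \<theta>" "\<theta> \<le> pi"
    and M: "2 * M \<le> r" "real r / (4 * x) \<le> real M"
  shows "real r / (2048 * x ^ 3) \<le> (\<Sum>j\<in>{r - 2 * M<..r}. 1 + cos (real j * \<theta>))"
proof (cases "real r * \<theta> \<le> 1")
  case True
  have "real r / (2048 * x ^ 3) \<le> real r / (4 * x)"
    using x self_le_power[of x 3] by (intro divide_left_mono) auto
  also have "\<dots> \<le> real (card {r - 2 * M<..r})" using M by simp
  also have "\<dots> = (\<Sum>j\<in>{r - 2 * M<..r}. 1)" by simp
  also have "\<dots> \<le> (\<Sum>j\<in>{r - 2 * M<..r}. 1 + cos (real j * \<theta>))"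
  proof (rule sum_mono)
    fix j assume "j \<in> {r - 2 * M<..r}"
    then have "real j * \<theta> \<le> real r * \<theta>" using \<theta> by (intro mult_right_mono) auto
    then have "0 \<le> cos (real j * \<theta>)"
      using True \<theta> pi_gt3 by (intro cos_ge_zero) (auto intro: order_trans[of _ 0])
    then show "1 \<le> 1 + cos (real j * \<theta>)" by simp
  qed
  finally show ?thesis .
next
  case False
  define \<phi> where "\<phi> = \<theta> / 2"
  have r: "real r > 0" using x by linarith
  have \<phi>: "1 / (2 * real r) < \<phi>" "\<phi> \<le> pi / 2"
    using False \<theta> r by (auto simp: \<phi>_def field_simps)
  then have \<phi>0: "\<phi> > 0" using r by (meson divide_pos_pos less_trans mult_pos_pos zero_less_numeral zero_less_one)
  \<comment> \<open>The largest step \<open>h \<le> M\<close> for which \<open>h \<phi>\<close> does not pass \<open>\<pi>/2\<close>.\<close>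
  have "\<exists>h\<le>M. 1 / (8 * x) \<le> real h * \<phi> \<and> real h * \<phi> \<le> pi / 2"
  proof (cases "real M * \<phi> \<le> pi / 2")
    case True
    have "1 / (8 * x) = real r / (4 * x) * (1 / (2 * real r))" using r x by (simp add: field_simps)
    also have "\<dots> \<le> real M * \<phi>" using M \<phi> x r by (intro mult_mono) auto
    finally show ?thesis using True by blast
  next
    case False
    define y where "y = pi / (2 * \<phi>)"
    have y: "1 \<le> y" "y < real M" "y * \<phi> = pi / 2"
      using \<phi> \<phi>0 False by (auto simp: y_def field_simps)
    define h where "h = nat \<lfloor>y\<rfloor>"
    have h: "y / 2 \<le> real h" "real h \<le> y" using nat_floor_ge_half[OF y(1)] by (auto simp: h_def)
    have "h \<le> M" using h y by linarith
    moreover have "real h * \<phi> \<le> pi / 2"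
      unfolding y(3)[symmetric] using h \<phi>0 by (intro mult_right_mono) auto
    moreover have "1 / (8 * x) \<le> 1 / 8" using x by (simp add: field_simps)
    then have "1 / (8 * x) \<le> y / 2 * \<phi>" using y(3) pi_gt3 by simp
    then have "1 / (8 * x) \<le> real h * \<phi>"
      using h \<phi>0 by (meson mult_right_mono less_imp_le order_trans)
    ultimately show ?thesis by blast
  qed
  then obtain h where h: "h \<le> M" "1 / (8 * x) \<le> real h * \<phi>" "real h * \<phi> \<le> pi / 2" by blast
  have "1 / (16 * x) \<le> real h * \<phi> / 2" using h(2) by simp
  also have "\<dots> \<le> sin (real h * \<phi>)" using h \<phi>0 by (intro sin_ge_half) auto
  finally have "(1 / (16 * x))\<^sup>2 \<le> (sin (real h * \<phi>))\<^sup>2" using x by (intro power_mono) auto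
  then have "real r / (4 * x) / 2 * (1 / (16 * x))\<^sup>2 \<le> real M / 2 * (sin (real h * \<phi>))\<^sup>2"
    using M x by (intro mult_mono divide_right_mono) auto
  also have "\<dots> = real M / 2 * (sin (real h * \<theta> / 2))\<^sup>2" by (simp add: \<phi>_def)
  also have "\<dots> \<le> (\<Sum>j\<in>{r - 2 * M<..r}. 1 + cos (real j * \<theta>))"
    by (rule sum_one_plus_cos_ge) (use h M in auto)
  also have "real r / (4 * x) / 2 * (1 / (16 * x))\<^sup>2 = real r / (2048 * x ^ 3)"
    by (simp add: power2_eq_square power3_eq_cube)
  finally show ?thesis .
qed

text \<open>Only the last \<open>r/x\<close> terms matter: there \<open>exp (x j/r)\<close> is still at least \<open>exp (x - 1)\<close>.\<close>

lemma exp_cos_sum_ge: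
  fixes x \<theta> :: real
  assumes x: "1 \<le> x" "2 * x \<le> real r" and \<theta>: "0 \<le> \<theta>" "\<theta> \<le> pi"
  shows "exp (x - 1) / (2048 * x ^ 3) \<le>
    (\<Sum>j=1..r. exp (x * real j / real r) * (1 + cos (real j * \<theta>)) / real j)"
proof -
  define c where "c j = 1 + cos (real j * \<theta>)" for j
  have c: "0 \<le> c j" for j using cos_ge_minus_one[of "real j * \<theta>"] unfolding c_def by linarith
  \<comment> \<open>Then \<open>2 * M \<le> r / x\<close>, which keeps
    \<open>x * j / r \<ge> x - 1\<close> in the window, while \<open>2 * x \<le> r\<close> makes
    rounding down cost at most a factor 2.\<close>
  define y where "y = real r / (2 * x)"
  define M where "M = nat \<lfloor>y\<rfloor>"
  have y1: "1 \<le> y" using x by (simp add: y_def field_simps)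
  have M: "y / 2 \<le> real M" "real M \<le> y" using nat_floor_ge_half[OF y1] by (auto simp: M_def)
  have r: "real r > 0" using x by linarith
  have xM: "real (2 * M) \<le> real r / x" using M(2) by (simp add: y_def)
  also have "\<dots> \<le> real r" using x by (simp add: field_simps mult_le_cancel_left1)
  finally have M2: "2 * M \<le> r" by simp
  have top: "exp (x - 1) / real r * c j \<le> exp (x * real j / real r) * c j / real j"
    if j: "j \<in> {r - 2 * M<..r}" for j
  proof -
    have "real r - real r / x \<le> real j" using j M2 xM by (auto simp: of_nat_diff)
    then have "x * (real r - real r / x) / real r \<le> x * real j / real r"
      using x r by (intro divide_right_mono mult_left_mono) auto
    also have "x * (real r - real r / x) / real r = x - 1" using x r by (simp add: field_simps)
    finally have "exp (x - 1) / real r \<le> exp (x * real j / real r) / real j"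
      using j r by (intro frac_le) auto
    then show ?thesis using mult_right_mono[OF _ c[of j]] by fastforce
  qed
  have "exp (x - 1) / (2048 * x ^ 3) = exp (x - 1) / real r * (real r / (2048 * x ^ 3))"
    using r by simp
  also have "\<dots> \<le> exp (x - 1) / real r * (\<Sum>j\<in>{r - 2 * M<..r}. c j)"
    unfolding c_def using M M2 x \<theta> by (intro mult_left_mono sum_top_one_plus_cos_ge) (auto simp: y_def)
  also have "\<dots> \<le> (\<Sum>j\<in>{r - 2 * M<..r}. exp (x * real j / real r) * c j / real j)"
    unfolding sum_distrib_left by (rule sum_mono) (rule top)
  also have "\<dots> \<le> (\<Sum>j=1..r. exp (x * real j / real r) * c j / real j)"
    by (rule sum_mono2) (use c in auto)
  finally show ?thesis by (simp add: c_def)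
qed

section \<open>Cauchy's inequality on the circle of radius \<open>exp (x / r)\<close>\<close>

lemma norm_short_gf_le:
  assumes x: "1 \<le> x" "2 * x \<le> real r" and z: "norm z = exp (x / real r)"
  shows "norm (short_gf r z) \<le>
    exp (harm r + exp_mean_int x + exp x / real r - exp (x - 1) / (2048 * x ^ 3))"
proof -
  define \<theta> where "\<theta> = \<bar>Arg z\<bar>"
  have r: "r \<ge> 1" using x by linarith
  have \<theta>: "0 \<le> \<theta>" "\<theta> \<le> pi" using Arg_bounded[of z] by (auto simp: \<theta>_def)
  have pow: "Re (z ^ j) = exp (x * real j / real r) * cos (real j * \<theta>)" for j
  proof -
    have "z ^ j = rcis (norm z) (Arg z) ^ j" by (simp add: rcis_cmod_Arg)
    also have "\<dots> = rcis (norm z ^ j) (real j * Arg z)" by (rule DeMoivre2)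
    finally have "Re (z ^ j) = norm z ^ j * cos (real j * Arg z)" by simp
    moreover have "cos (real j * Arg z) = cos (real j * \<theta>)"
      unfolding \<theta>_def by (cases "Arg z \<ge> 0") auto
    moreover have "norm z ^ j = exp (x * real j / real r)"
      by (simp add: z exp_of_nat_mult[symmetric] mult.commute)
    ultimately show ?thesis by simp
  qed
  have "Re (- (\<Sum>j=1..r. z ^ j / of_nat j)) = (\<Sum>j=1..r. - (Re (z ^ j) / real j))"
    by (simp add: sum_negf)
  \<comment> \<open>Writing \<open>- cos\<close> as \<open>1 - (1 + cos)\<close> separates the
    harmonic number, the Riemann sum and the gain from the angles.\<close>
  also have "\<dots> = (\<Sum>j=1..r. 1 / real j + (exp (x * real j / real r) - 1) / real j
      - exp (x * real j / real r) * (1 + cos (real j * \<theta>)) / real j)"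
    unfolding pow by (intro sum.cong refl) (simp add: field_simps)
  also have "\<dots> = harm r + (\<Sum>j=1..r. (exp (x * real j / real r) - 1) / real j)
      - (\<Sum>j=1..r. exp (x * real j / real r) * (1 + cos (real j * \<theta>)) / real j)"
    by (simp add: sum.distrib sum_subtractf harm_def inverse_eq_divide)
  also have "\<dots> \<le> harm r + (exp_mean_int x + exp x / real r) - exp (x - 1) / (2048 * x ^ 3)"
    using x by (intro diff_mono add_mono order_refl sum_exp_le_exp_mean_int exp_cos_sum_ge r \<theta>) auto
  finally show ?thesis unfolding short_gf_def norm_exp_eq_Re by simp
qed

lemma sum_inverse_powers_le:
  fixes R :: real
  assumes "R > 1"
  shows "(\<Sum>i=n..<N. 1 / R ^ Suc i) \<le> 1 / (R ^ n * (R - 1))"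
proof (cases "n \<le> N")
  case True
  have "1 / R ^ Suc i = - 1 / (R ^ Suc i * (R - 1)) - (- 1 / (R ^ i * (R - 1)))" for i
    using assms by (simp add: divide_simps)
  then have "(\<Sum>i=n..<N. 1 / R ^ Suc i) =
      (\<Sum>i=n..<N. - 1 / (R ^ Suc i * (R - 1)) - (- 1 / (R ^ i * (R - 1))))"
    by (rule sum.cong[OF refl])
  also have "\<dots> = - 1 / (R ^ N * (R - 1)) - (- 1 / (R ^ n * (R - 1)))"
    using True by (rule sum_Suc_diff')
  also have "\<dots> \<le> 1 / (R ^ n * (R - 1))" using assms by simp
  finally show ?thesis .
qed (use assms in auto)

text \<open>Three factors \<open>r\<close> are lost: \<open>1 / (R - 1) \<le> r\<close>,
  \<open>exp (harm r) \<le> exp 1 * r\<close>, and the division by \<open>r\<close> in the claim.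
  The factor \<open>exp x\<close> pays for \<open>u + 1\<close> instead of \<open>u\<close> in
  \<open>dickman_lower_bound\<close>.\<close>

lemma kappa_limit_le_many:
  assumes x: "1 \<le> x" "2 * x \<le> real r" "exp_mean x = real n / real r + 1"
  shows "\<bar>kappa n r - exp (- harm r)\<bar> \<le>
    2 * exp (3 * ln (real r) + x + 1 + exp x / real r - exp (x - 1) / (2048 * x ^ 3)) *
      (dickman (real n / real r) / real r)"
proof -
  define u where "u = real n / real r"
  define R where "R = exp (x / real r)"
  define s where "s = exp x / real r - exp (x - 1) / (2048 * x ^ 3)"
  define L where "L = exp (harm r + exp_mean_int x + s)"
  have r: "r \<ge> 1" using x by linarith
  have "1 / real r \<le> x / real r" using x by (simp add: divide_right_mono)
  also have "\<dots> \<le> R - 1" unfolding R_def using exp_ge_add_one_self[of "x / real r"] by linarith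
  finally have R1: "1 / real r \<le> R - 1" .
  moreover have "1 / real r > 0" using r by simp
  ultimately have R: "R > 1" by linarith
  have Rn: "R ^ n = exp (x * u)"
    by (simp add: R_def u_def exp_of_nat_mult[symmetric] mult.commute)
  have "\<bar>kappa n r - exp (- harm r)\<bar> \<le> L * (1 / (R ^ n * (R - 1)))"
  proof (rule kappa_minus_limit_le)
    fix N
    have "norm (short_gf r z) \<le> L" if "norm z = R" for z
      using norm_short_gf_le[OF x(1,2)] that by (simp add: L_def s_def R_def add_diff_eq)
    then have "\<bar>kappa (Suc i) r - kappa i r\<bar> \<le> L * (1 / R ^ Suc i)" for i
      using kappa_diff_Cauchy[of R r L i] R by simp
    then have "(\<Sum>i=n..<N. \<bar>kappa (Suc i) r - kappa i r\<bar>) \<le> (\<Sum>i=n..<N. L * (1 / R ^ Suc i))"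
      by (rule sum_mono)
    also have "\<dots> \<le> L * (1 / (R ^ n * (R - 1)))"
      unfolding sum_distrib_left[symmetric]
      by (intro mult_left_mono sum_inverse_powers_le R) (simp add: L_def)
    finally show "(\<Sum>i=n..<N. \<bar>kappa (Suc i) r - kappa i r\<bar>) \<le> L * (1 / (R ^ n * (R - 1)))" .
  qed
  also have "\<dots> \<le> L * (real r * exp (- (x * u)))"
  proof (rule mult_left_mono)
    have "1 / (R ^ n * (R - 1)) \<le> 1 / (R ^ n * (1 / real r))"
      using R1 R r by (intro divide_left_mono mult_left_mono) auto
    then show "1 / (R ^ n * (R - 1)) \<le> real r * exp (- (x * u))"
      by (simp add: Rn exp_minus field_simps)
  qed (simp add: L_def)
  \<comment> \<open>\<open>harm r - ln r\<close> decreases from its value 1 at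
    \<open>r = 1\<close>.\<close>
  also have "\<dots> \<le> exp (ln (real r) + 1 + exp_mean_int x + s) * (real r * exp (- (x * u)))"
    unfolding L_def using decseqD[OF decseq_harm_diff_ln, of 0 "r - 1"] r
    by (intro mult_right_mono) (simp_all add: harm_expand)
  also have "exp (ln (real r) + 1 + exp_mean_int x + s) * (real r * exp (- (x * u))) =
      real r ^ 2 * exp (1 + x + s) * exp (exp_mean_int x - x * (u + 1))"
    using r by (simp add: exp_add exp_diff exp_minus field_simps power2_eq_square)
  also have "\<dots> \<le> real r ^ 2 * exp (1 + x + s) * (2 * dickman u)"
    using dickman_lower_bound[of u x] x by (intro mult_left_mono) (auto simp: u_def)
  also have "\<dots> = 2 * (real r ^ 3 * exp (1 + x + s)) * (dickman u / real r)"
    using r by (simp add: power2_eq_square power3_eq_cube)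
  also have "real r ^ 3 * exp (1 + x + s) = exp (3 * ln (real r) + x + 1 + s)"
    using r exp_of_nat_mult[of 3 "ln (real r)"] by (simp add: exp_add)
  finally show ?thesis by (simp add: u_def s_def add_diff_eq)
qed

lemma kappa_limit_le_many_uniform:
  "\<exists>K\<ge>1. \<forall>n r. 2 \<le> n \<longrightarrow> ln (real n) ^ 4 \<le> real r \<longrightarrow> r < n \<longrightarrow> K * real r < (real n / real r)\<^sup>2 \<longrightarrow>
    \<bar>kappa n r - exp (- harm r)\<bar> \<le> 2 * (dickman (real n / real r) / real r)"
proof -
  \<comment> \<open>In the last clause \<open>9 * x\<close> stands for \<open>3 * ln r\<close> and
    \<open>(x / 4) ^ 4\<close> for \<open>r\<close>. It holds for large \<open>x\<close> since
    \<open>exp x / x ^ 4\<close> is of smaller order than \<open>exp x / x ^ 3\<close>; here the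
    fourth power of the logarithm matters.\<close>
  define P where "P x \<longleftrightarrow> 1 \<le> x \<and> exp (x / 2) \<le> (exp x - 1) / x \<and> 2 * x \<le> (x / 4) ^ 4 \<and>
      9 * x + x + 1 + exp x / (x / 4) ^ 4 - exp (x - 1) / (2048 * x ^ 3) \<le> 0" for x :: real
  have "\<forall>\<^sub>F x::real in at_top. 1 \<le> x" by (rule eventually_ge_at_top)
  moreover have "\<forall>\<^sub>F x::real in at_top. exp (x / 2) \<le> (exp x - 1) / x" by real_asymp
  moreover have "\<forall>\<^sub>F x::real in at_top. 2 * x \<le> (x / 4) ^ 4" by real_asymp
  moreover have "\<forall>\<^sub>F x::real in at_top.
      9 * x + x + 1 + exp x / (x / 4) ^ 4 - exp (x - 1) / (2048 * x ^ 3) \<le> 0" by real_asymp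
  ultimately have "\<forall>\<^sub>F x in at_top. P x"
    by eventually_elim (simp add: P_def)
  then obtain x0 where x0: "\<And>x. x0 \<le> x \<Longrightarrow> P x"
    by (auto simp: eventually_at_top_linorder)
  \<comment> \<open>With this \<open>K\<close>, \<open>K * r < u\<^sup>2\<close> forces
    \<open>exp_mean x0 < u\<close>, hence \<open>x0 \<le> x\<close>.\<close>
  define K where "K = (exp_mean x0)\<^sup>2"
  have x01: "1 \<le> x0" using x0[of x0] by (simp add: P_def)
  then have E1: "1 \<le> exp_mean x0" using exp_mean_ge[of x0] by simp
  have K1: "1 \<le> K" using E1 by (simp add: K_def)
  show ?thesis
  proof (intro exI[of _ K] conjI K1 allI impI)
    fix n r :: nat
    assume n: "2 \<le> n" and r: "ln (real n) ^ 4 \<le> real r" "r < n"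
      and u2: "K * real r < (real n / real r)\<^sup>2"
    define u where "u = real n / real r"
    define x where "x = exp_mean_inv (u + 1)"
    have ln0: "ln (real n) > 0" using n by simp
    then have r0: "0 < real r" using r by (smt (verit) zero_less_power)
    then have r1: "1 \<le> real r" by simp
    have u1: "1 \<le> u" using r r0 by (simp add: u_def field_simps)
    have x: "0 \<le> x" "exp_mean x = u + 1" using exp_mean_inv[of "u + 1"] u1 by (auto simp: x_def)
    have "K * 1 \<le> K * real r" using K1 r1 by (intro mult_left_mono) auto
    then have "(exp_mean x0)\<^sup>2 < u\<^sup>2" using u2 by (simp add: K_def u_def)
    then have "exp_mean x0 < u" using u1 by (metis power2_less_imp_less zero_le_one order_trans)
    then have "x0 \<le> x"
      using x exp_mean_strict_mono[of x x0] x01 by (cases "x0 \<le> x") auto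
    note x0 = x0[OF this, unfolded P_def]
    then have x1: "1 \<le> x" by simp
    have nu: "real n = u * real r" using r0 by (simp add: u_def)
    \<comment> \<open>From \<open>r \<le> u\<^sup>2\<close> follows
      \<open>n = u * r \<le> u ^ 3\<close>, so powers of \<open>n\<close> cost only multiples of
      \<open>x\<close> in the exponent.\<close>
    have "real r \<le> K * real r" using K1 r0 by simp
    then have "real r \<le> u\<^sup>2" using u2 by (simp add: u_def)
    then have "real n \<le> u ^ 3"
      unfolding nu using u1 by (simp add: power3_eq_cube power2_eq_square mult_left_mono)
    then have "ln (real n) \<le> ln (u ^ 3)" using n u1 by (subst ln_le_cancel_iff) auto
    also have "\<dots> = 3 * ln u" using u1 by (simp add: ln_realpow)
    also have "ln u \<le> x"
    proof -
      have "u + 1 \<le> x * (u + 1)" using x1 u1 by simp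
      also have "\<dots> = exp x - 1" using x x1 by (simp add: exp_mean_def field_simps split: if_splits)
      finally have "u \<le> exp x" by simp
      then have "ln u \<le> ln (exp x)" using u1 by (subst ln_le_cancel_iff) auto
      then show ?thesis by simp
    qed
    finally have ln_le: "ln (real n) \<le> 3 * x" by simp
    \<comment> \<open>Conversely \<open>x\<close> is at most \<open>4 * ln n\<close>, which turns
      the assumption on \<open>r\<close> into \<open>(x / 4) ^ 4 \<le> r\<close>.\<close>
    have "exp (x / 2) \<le> u + 1" using x0 x x1 by (simp add: exp_mean_def split: if_splits)
    also have "\<dots> \<le> 2 * u" using u1 by simp
    also have "\<dots> \<le> real n * real n"
    proof (rule mult_mono)
      show "u \<le> real n" using r1 by (simp add: u_def divide_le_eq mult_le_cancel_left1)
    qed (use n u1 in auto)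
    also have "\<dots> = exp (ln (real n) + ln (real n))" using n by (subst exp_add) simp
    finally have "x / 4 \<le> ln (real n)" by simp
    then have "(x / 4) ^ 4 \<le> ln (real n) ^ 4" using x1 by (intro power_mono) auto
    then have rx: "(x / 4) ^ 4 \<le> real r" using r by linarith
    then have "2 * x \<le> real r" using x0 by linarith
    have "exp x / real r \<le> exp x / (x / 4) ^ 4"
      using rx x1 r0 by (intro divide_left_mono mult_pos_pos) auto
    moreover have "3 * ln (real r) \<le> 9 * x" 
    proof -
      have "ln (real r) \<le> ln (real n)" using r r0 by (subst ln_le_cancel_iff) auto
      then show ?thesis using ln_le by simp
    qed
    ultimately have le0: "3 * ln (real r) + x + 1 + exp x / real r - exp (x - 1) / (2048 * x ^ 3) \<le> 0"
      using x0 by linarith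
    have "\<bar>kappa n r - exp (- harm r)\<bar> \<le>
      2 * exp (3 * ln (real r) + x + 1 + exp x / real r - exp (x - 1) / (2048 * x ^ 3)) *
        (dickman (real n / real r) / real r)"
      by (rule kappa_limit_le_many) (use x x1 \<open>2 * x \<le> real r\<close> in \<open>auto simp: u_def\<close>)
    also have "\<dots> \<le> 2 * 1 * (dickman (real n / real r) / real r)"
      using le0 dickman_pos[of "real n / real r"]
      by (intro mult_right_mono mult_left_mono) (auto intro!: divide_nonneg_nonneg)
    finally show "\<bar>kappa n r - exp (- harm r)\<bar> \<le> 2 * (dickman (real n / real r) / real r)" by simp
  qed
qed

theorem theorem2:
  shows "\<exists>C::real. C > 0 \<and>
    (\<forall>n r :: nat. n \<ge> 2 \<longrightarrow> (ln (real n)) ^ 4 \<le> real r \<longrightarrow> r < n \<longrightarrow>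
       \<bar>kappa n r - exp (- (harm r :: real))\<bar> \<le> C * (dickman (real n / real r) / real r))"
proof -
  obtain K where K: "K \<ge> 1" and many: "\<And>n r. 2 \<le> n \<Longrightarrow> ln (real n) ^ 4 \<le> real r \<Longrightarrow> r < n \<Longrightarrow>
      K * real r < (real n / real r)\<^sup>2 \<Longrightarrow>
      \<bar>kappa n r - exp (- harm r)\<bar> \<le> 2 * (dickman (real n / real r) / real r)"
    using kappa_limit_le_many_uniform by blast
  define A where "A = 4 / dickman 2 * exp (4 * K)"
  have A: "0 < A" using dickman_pos[of 2] by (simp add: A_def)
  show ?thesis
  proof (intro exI[of _ "A + 2"] conjI allI impI)
    fix n r :: nat
    assume n: "2 \<le> n" and r: "ln (real n) ^ 4 \<le> real r" "r < n"
    have "0 < ln (real n) ^ 4" using n by simp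
    then have r1: "r \<ge> 1" using r by (cases r) auto
    have nn: "0 \<le> dickman (real n / real r) / real r"
      using dickman_pos[of "real n / real r"] by (auto intro!: divide_nonneg_nonneg)
    have "\<bar>kappa n r - exp (- harm r)\<bar> \<le> max A 2 * (dickman (real n / real r) / real r)"
    proof (cases "K * real r < (real n / real r)\<^sup>2")
      case True
      then show ?thesis
        using many[OF n r] mult_right_mono[OF max.cobounded2[of 2 A] nn] by linarith
    next
      case False
      then show ?thesis
        using kappa_limit_le_few[OF r1 r(2), of K] mult_right_mono[OF max.cobounded1[of A 2] nn]
        unfolding A_def by linarith
    qed
    also have "\<dots> \<le> (A + 2) * (dickman (real n / real r) / real r)"
      using A nn by (intro mult_right_mono) auto
    finally show "\<bar>kappa n r - exp (- harm r)\<bar> \<le> (A + 2) * (dickman (real n / real r) / real r)" .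
  qed (use A in auto)
qed

end
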